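(* Let $p$ be a prime and let $G$ be the group given by the presentation $$G=\langle x,y,t \mid x^t=x^p,\ y^{t^{-1}}=y^p,\ [x,y]=1,\ [[x,y^{jt^i}],x]=1 \text{ for all } i,j\in\mathbb Z\rangle .$$ Then $G$ is solvable of class three (i.e. of derived length three). Moreover, let $w(x_1,x_2,x_3)=[x_1,[x_2,x_3]]^p$. Then $w$ is an unbounded iterated identity for $G$; that is: (1) for all $g_1,g_2,g_3\in G$ there exists an integer $j\ge 0$ (depending on $g_1,g_2,g_3$) such that $w^{(j)}(g_1,g_2,g_3)=1$ in $G$; and (2) there is no integer $j\ge 0$ such that $w^{(j)}(g_1,g_2,g_3)=1$ in $G$ for all $g_1,g_2,g_3\in G$.
   Context: Conventions: for elements $a,b$ of a group, $a^b=b^{-1}ab$ and $[a,b]=a^{-1}b^{-1}ab$. For $i,j\in\mathbb Z$, the notation $y^{jt^i}$ means $(y^j)^{t^i}=t^{-i}y^jt^i$. Iterations of a word: for a word $w=w(x_1,\dots,x_n)$ on $n\ge 1$ letters, define $w^{(0)}(x_1,\dots,x_n)=w(x_1,\dots,x_n)$ and $w^{(i+1)}(x_1,\dots,x_n)=w(w^{(i)}(x_1,\dots,x_n),x_2,\dots,x_n)$ for $i\ge 0$. A group $G$ satisfies the iterated identity $w$ if for any $x_1,\dots,x_n\in G$ there exists $j$ (depending in general on $x_1,\dots,x_n$) such that $w^{(j)}(x_1,\dots,x_n)=1$. An iterated identity $w$ of $G$ is unbounded if there is no single $j$ such that $w^{(j)}(x_1,\dots,x_n)=1$ for all $x_1,\dots,x_n\in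 G$. *)

theory Defs
  imports "HOL-Algebra.Solvable_Groups" "HOL-Computational_Algebra.Primes"
begin

section \<open>Free groups\<close>

text \<open>
  A letter \<open>(a, True)\<close> stands for the generator \<open>a\<close>, and \<open>(a, False)\<close> for its inverse.
  The free group on \<open>X\<close> consists of the reduced words over \<open>X\<close>; the product is concatenation
  followed by free reduction.
\<close>

type_synonym 'a letter = "'a \<times> bool"

definition inv_letter :: "'a letter \<Rightarrow> 'a letter" where
  "inv_letter l = (fst l, \<not> snd l)"

definition reduced :: "'a letter list \<Rightarrow> bool" where
  "reduced u \<longleftrightarrow> successively (\<lambda>k l. l \<noteq> inv_letter k) u"

fun push_letter :: "'a letter \<Rightarrow> 'a letter list \<Rightarrow> 'a letter list" where
  "push_letter l [] = [l]"
| "push_letter l (k # u) = (if k = inv_letter l then u else l # k # u)"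

definition free_group :: "'a set \<Rightarrow> 'a letter list monoid" where
  "free_group X =
     \<lparr>carrier = {u. reduced u \<and> fst ` set u \<subseteq> X},
      monoid.mult = (\<lambda>u v. foldr push_letter u v),
      one = []\<rparr>"

definition free_gen :: "'a \<Rightarrow> 'a letter list" where
  "free_gen a = [(a, True)]"

lemma inv_letter_inv_letter [simp]: "inv_letter (inv_letter l) = l"
  by (simp add: inv_letter_def)

lemma fst_inv_letter [simp]: "fst (inv_letter l) = fst l"
  by (simp add: inv_letter_def)

lemma inv_letter_eq_iff: "k = inv_letter l \<longleftrightarrow> l = inv_letter k"
  by auto

lemma reduced_Nil [simp]: "reduced []"
  by (simp add: reduced_def)

lemma reduced_Cons:
  "reduced (l # u) \<longleftrightarrow> reduced u \<and> (u = [] \<or> hd u \<noteq> inv_letter l)"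
  by (cases u) (auto simp: reduced_def)

lemma reduced_push_letter: "reduced u \<Longrightarrow> reduced (push_letter l u)"
  by (cases u) (auto simp: reduced_Cons)

lemma reduced_foldr_push_letter: "reduced v \<Longrightarrow> reduced (foldr push_letter u v)"
  by (induction u) (auto intro: reduced_push_letter)

lemma set_push_letter: "set (push_letter l u) \<subseteq> insert l (set u)"
  by (cases u) auto

lemma set_foldr_push_letter: "set (foldr push_letter u v) \<subseteq> set u \<union> set v"
  using set_push_letter by (induction u) fastforce+

lemma push_letter_cancel:
  "reduced u \<Longrightarrow> push_letter l (push_letter (inv_letter l) u) = u"
  by (cases u rule: list.exhaust; cases "tl u") (auto simp: reduced_Cons)

lemma foldr_push_letter_reduced: "reduced u \<Longrightarrow> foldr push_letter u [] = u"
proof (induction u)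
  case (Cons l u)
  then show ?case by (cases u) (auto simp: reduced_Cons)
qed simp

lemma foldr_push_letter_push_letter:
  assumes "reduced v"
  shows "foldr push_letter (push_letter l u) v = push_letter l (foldr push_letter u v)"
proof (cases u)
  case (Cons k u')
  then show ?thesis
    using push_letter_cancel[OF reduced_foldr_push_letter[OF assms], of l u'] by auto
qed simp

lemma foldr_push_letter_assoc:
  assumes "reduced x"
  shows "foldr push_letter (foldr push_letter u v) x = foldr push_letter u (foldr push_letter v x)"
  by (induction u) (simp_all add: foldr_push_letter_push_letter[OF assms])

lemma foldr_push_letter_inverse:
  assumes "reduced v"
  shows "foldr push_letter (map inv_letter (rev u)) (foldr push_letter u v) = v"
  using assms
proof (induction u arbitrary: v)
  case (Cons l u)
  then show ?case
    using push_letter_cancel[OF reduced_foldr_push_letter[OF Cons.prems], of "inv_letter l" u]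
    by simp
qed simp

lemma reduced_inverse: "reduced u \<Longrightarrow> reduced (map inv_letter (rev u))"
  unfolding reduced_def successively_map successively_rev
  by (erule successively_mono) (auto simp: inv_letter_def prod_eq_iff)

theorem group_free_group: "group (free_group X)"
proof (rule groupI)
  fix u assume u: "u \<in> carrier (free_group X)"
  let ?v = "map inv_letter (rev u)"
  have "?v \<in> carrier (free_group X)"
    using u by (auto simp: free_group_def reduced_inverse)
  moreover have "foldr push_letter ?v u = []"
    using u foldr_push_letter_inverse[of "[]" u] foldr_push_letter_reduced[of u]
    by (simp add: free_group_def)
  ultimately show "\<exists>v\<in>carrier (free_group X). v \<otimes>\<^bsub>free_group X\<^esub> u = \<one>\<^bsub>free_group X\<^esub>"
    by (intro bexI[of _ ?v]) (simp_all add: free_group_def)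
qed (use set_foldr_push_letter in
      \<open>fastforce simp: free_group_def reduced_foldr_push_letter foldr_push_letter_assoc\<close>)+

lemma free_gen_carrier: "a \<in> X \<Longrightarrow> free_gen a \<in> carrier (free_group X)"
  by (simp add: free_group_def free_gen_def reduced_Cons)


section \<open>Group presentations\<close>

definition normal_closure :: "('a, 'b) monoid_scheme \<Rightarrow> 'a set \<Rightarrow> 'a set" where
  "normal_closure G R = \<Inter>{N. N \<lhd> G \<and> R \<subseteq> N}"

text \<open>A pair \<open>(u, v)\<close> stands for the defining relation \<open>u = v\<close>.\<close>

definition presented_group ::
    "'a set \<Rightarrow> ('a letter list \<times> 'a letter list) set \<Rightarrow> 'a letter list set monoid" where
  "presented_group X R =
     free_group X Mod
       normal_closure (free_group X)
         {u \<otimes>\<^bsub>free_group X\<^esub> inv\<^bsub>free_group X\<^esub> v | u v. (u, v) \<in> R}"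


section \<open>Conjugates, commutators, derived length\<close>

definition conjugate :: "('a, 'b) monoid_scheme \<Rightarrow> 'a \<Rightarrow> 'a \<Rightarrow> 'a" where
  "conjugate G a b = inv\<^bsub>G\<^esub> b \<otimes>\<^bsub>G\<^esub> a \<otimes>\<^bsub>G\<^esub> b"

definition commutator :: "('a, 'b) monoid_scheme \<Rightarrow> 'a \<Rightarrow> 'a \<Rightarrow> 'a" where
  "commutator G a b = inv\<^bsub>G\<^esub> a \<otimes>\<^bsub>G\<^esub> inv\<^bsub>G\<^esub> b \<otimes>\<^bsub>G\<^esub> a \<otimes>\<^bsub>G\<^esub> b"

text \<open>Only meaningful for solvable \<open>G\<close>.\<close>

definition derived_length :: "('a, 'b) monoid_scheme \<Rightarrow> nat" where
  "derived_length G = (LEAST n. (derived G ^^ n) (carrier G) = {\<one>\<^bsub>G\<^esub>})"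


section \<open>Iterated identities\<close>

text \<open>
  A word on \<open>n\<close> letters is an element of the free group on \<open>{1..n}\<close>. The value of \<open>w\<close>
  at an assignment \<open>g\<close> of the letters to elements of \<open>G\<close> is \<open>word_value G w g\<close>.
\<close>

definition word_value ::
    "('a, 'b) monoid_scheme \<Rightarrow> nat letter list \<Rightarrow> (nat \<Rightarrow> 'a) \<Rightarrow> 'a" where
  "word_value G w g =
     foldr (\<lambda>(i, s) z. (if s then g i else inv\<^bsub>G\<^esub> (g i)) \<otimes>\<^bsub>G\<^esub> z) w \<one>\<^bsub>G\<^esub>"

primrec iterated_value ::
    "('a, 'b) monoid_scheme \<Rightarrow> nat letter list \<Rightarrow> nat \<Rightarrow> (nat \<Rightarrow> 'a) \<Rightarrow> 'a" where
  "iterated_value G w 0 g = word_value G w g"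
| "iterated_value G w (Suc i) g = word_value G w (g(1 := iterated_value G w i g))"

definition satisfies_iterated_identity ::
    "('a, 'b) monoid_scheme \<Rightarrow> nat \<Rightarrow> nat letter list \<Rightarrow> bool" where
  "satisfies_iterated_identity G n w \<longleftrightarrow>
     (\<forall>g \<in> {1..n} \<rightarrow> carrier G. \<exists>j. iterated_value G w j g = \<one>\<^bsub>G\<^esub>)"

definition unbounded_iterated_identity ::
    "('a, 'b) monoid_scheme \<Rightarrow> nat \<Rightarrow> nat letter list \<Rightarrow> bool" where
  "unbounded_iterated_identity G n w \<longleftrightarrow>
     satisfies_iterated_identity G n w \<and>
     \<not> (\<exists>j. \<forall>g \<in> {1..n} \<rightarrow> carrier G. iterated_value G w j g = \<one>\<^bsub>G\<^esub>)"


section \<open>The group and the word\<close>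

datatype generator = gen_x | gen_y | gen_t

definition relations ::
    "nat \<Rightarrow> (generator letter list \<times> generator letter list) set" where
  "relations p =
     (let F = free_group UNIV; x = free_gen gen_x; y = free_gen gen_y; t = free_gen gen_t in
       {(conjugate F x t, x [^]\<^bsub>F\<^esub> p),
        (conjugate F y (inv\<^bsub>F\<^esub> t), y [^]\<^bsub>F\<^esub> p),
        (commutator F x y, \<one>\<^bsub>F\<^esub>)} \<union>
       {(commutator F (commutator F x (conjugate F (y [^]\<^bsub>F\<^esub> j) (t [^]\<^bsub>F\<^esub> i))) x, \<one>\<^bsub>F\<^esub>)
         | (i :: int) (j :: int). True})"

definition G_group :: "nat \<Rightarrow> generator letter list set monoid" where
  "G_group p = presented_group UNIV (relations p)"

definition w_word :: "nat \<Rightarrow> nat letter list" where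
  "w_word p =
     (let F = free_group {1..3}
      in commutator F (free_gen 1) (commutator F (free_gen 2) (free_gen 3)) [^]\<^bsub>F\<^esub> p)"

end

theory Submission
  imports Defs Complex_Main
begin

text \<open>
  Conjugation by \<open>t\<close> raises \<open>x\<close> to the \<open>p\<close>-th power, conjugation by \<open>t\<inverse>\<close> does so to \<open>y\<close>. Hence
  \<open>x\<close> and \<open>y\<close> have \<open>p\<^sup>i\<close>-th roots \<open>x\<^sub>i\<close> and \<open>y\<^sub>i\<close> for all \<open>i\<close>, namely conjugates by powers of \<open>t\<close>. Any two
  \<open>x\<^sub>i\<close>, \<open>x\<^sub>j\<close> are powers of one root, so the relations
  \<open>[[x, y\<^bsup>jt\<^sup>i\<^esup>], x] = 1\<close> make all conjugates of the \<open>x\<^sub>i\<close> by powers of the \<open>y\<^sub>j\<close> commute: they generate an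
  abelian normal subgroup \<open>K\<close>. The relation \<open>[x, y] = 1\<close> gives \<open>[x\<^sub>i, y\<^sub>j] = 1\<close> for \<open>i + j \<le> 0\<close>, so
  \<open>[x\<^sub>i, y\<^sub>j]\<close> has order dividing \<open>p\<^sup>m\<close> once \<open>m \<ge> i + j\<close>. Let \<open>N\<close> be the normal closure of \<open>x\<close> and \<open>y\<close>.
  Then \<open>G' \<subseteq> N\<close>, and \<open>N'\<close> lies in the \<open>p\<close>-power torsion \<open>T\<close> of \<open>K\<close>, which is abelian. This gives
  \<open>G''' = 1\<close> (\<open>derived_3_trivial\<close>).

  Write \<open>z = [g\<^sub>2, g\<^sub>3] \<in> N\<close>. Iterating \<open>w\<close> is iterating \<open>u \<mapsto> [u, z]\<^sup>p\<close>. The first step leads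
  into \<open>N\<close> and the second into \<open>T\<close>. For \<open>u \<in> T\<close>, the commutator \<open>[u, z] = u\<inverse> u\<^sup>z\<close> is a product of two
  commuting elements with the exponent of \<open>u\<close>, so that the \<open>p\<close>-th power divides the exponent by \<open>p\<close>, and
  the sequence reaches \<open>1\<close> (\<open>satisfies_iterated_identity_w_word\<close>). The exponent of the element of \<open>T\<close>
  at the start is not bounded.

  That no number of iterations suffices for all elements is seen in a quotient of \<open>G\<close>.
  Let \<open>x\<close> act on triples \<open>(v, c, i) \<in> \<complex> \<times> \<real> \<times> \<int>\<close> by multiplying \<open>v\<close> with
  \<open>e(p\<^sup>i)\<close> if \<open>c\<close> is an integer, where \<open>e(r) = exp(2\<pi>\<i>r)\<close>; let \<open>y\<close> add \<open>p\<^sup>-\<^sup>i\<close> to \<open>c\<close>,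
  and let \<open>t\<close> add \<open>1\<close> to \<open>i\<close>. These maps satisfy the relations. For \<open>g\<^sub>1 = x\<^sub>n\<close>, \<open>g\<^sub>2 = y\<^sub>k\<close> and \<open>g\<^sub>3 = t\<close>, the iterates of \<open>w\<close> act by iterated differences of an indicator function, and
  at \<open>c = i = 0\<close> the \<open>j\<close>-th of them is multiplication by \<open>e(\<plusminus>p\<^sup>j\<^sup>+\<^sup>1 / p\<^sup>n)\<close>, which is not \<open>1\<close> for
  \<open>n = j + 2\<close> (\<open>G_group_iterated_value_ne_one\<close>). Because \<open>z\<close> and the values of \<open>w\<close> lie in \<open>G'\<close>, the
  values of \<open>w\<^bsup>(1)\<^esup>\<close> lie in \<open>G''\<close>; so the same computation shows \<open>G'' \<noteq> 1\<close>.
\<close>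

section \<open>Conjugates and commutators\<close>

lemma (in group) inv_mult_cancel_left:
  "a \<in> carrier G \<Longrightarrow> b \<in> carrier G \<Longrightarrow> inv a \<otimes> (a \<otimes> b) = b"
  by (simp add: m_assoc[symmetric])

lemma (in group) mult_inv_cancel_left:
  "a \<in> carrier G \<Longrightarrow> b \<in> carrier G \<Longrightarrow> a \<otimes> (inv a \<otimes> b) = b"
  by (simp add: m_assoc[symmetric])

lemma (in group) conjugate_closed [simp]:
  "a \<in> carrier G \<Longrightarrow> b \<in> carrier G \<Longrightarrow> conjugate G a b \<in> carrier G"
  by (simp add: conjugate_def)

lemma (in group) commutator_closed [simp]:
  "a \<in> carrier G \<Longrightarrow> b \<in> carrier G \<Longrightarrow> commutator G a b \<in> carrier G"
  by (simp add: commutator_def)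

lemma (in group) conjugate_one [simp]: "a \<in> carrier G \<Longrightarrow> conjugate G a \<one> = a"
  by (simp add: conjugate_def)

lemma (in group) conjugate_conjugate:
  assumes "a \<in> carrier G" "b \<in> carrier G" "c \<in> carrier G"
  shows "conjugate G (conjugate G a b) c = conjugate G a (b \<otimes> c)"
  using assms by (simp add: conjugate_def inv_mult_group m_assoc)

lemma (in group) conjugate_group_hom: "b \<in> carrier G \<Longrightarrow> group_hom G G (\<lambda>a. conjugate G a b)"
  by unfold_locales (auto simp: hom_def conjugate_def m_assoc mult_inv_cancel_left)

lemma (in group) conjugate_mult:
  assumes "a \<in> carrier G" "a' \<in> carrier G" "b \<in> carrier G"
  shows "conjugate G (a \<otimes> a') b = conjugate G a b \<otimes> conjugate G a' b"
  using group_hom.hom_mult[OF conjugate_group_hom] assms by simp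

lemma (in group) conjugate_inv:
  assumes "a \<in> carrier G" "b \<in> carrier G"
  shows "conjugate G (inv a) b = inv (conjugate G a b)"
  using group_hom.hom_inv[OF conjugate_group_hom] assms by simp

lemma (in group) conjugate_nat_pow:
  assumes "a \<in> carrier G" "b \<in> carrier G"
  shows "conjugate G (a [^] (n :: nat)) b = conjugate G a b [^] n"
  using group_hom.hom_nat_pow[OF conjugate_group_hom] assms by simp

lemma (in group) conjugate_int_pow:
  assumes "a \<in> carrier G" "b \<in> carrier G"
  shows "conjugate G (a [^] (n :: int)) b = conjugate G a b [^] n"
  using group_hom.hom_int_pow[OF conjugate_group_hom] assms by simp

lemma (in group) conjugate_conjugate_swap:
  assumes "a \<in> carrier G" "b \<in> carrier G" "c \<in> carrier G"
  shows "conjugate G (conjugate G a b) c = conjugate G (conjugate G a c) (conjugate G b c)"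
proof -
  have "c \<otimes> conjugate G b c = b \<otimes> c"
    using assms by (simp add: conjugate_def m_assoc mult_inv_cancel_left)
  then show ?thesis using assms by (simp add: conjugate_conjugate)
qed

lemma (in group) conjugate_eq_self:
  assumes "a \<otimes> b = b \<otimes> a" "a \<in> carrier G" "b \<in> carrier G"
  shows "conjugate G a b = a"
  using assms by (simp add: conjugate_def m_assoc mult_inv_cancel_left inv_mult_cancel_left)

lemma (in group) conjugate_commute:
  assumes "a \<otimes> a' = a' \<otimes> a" "a \<in> carrier G" "a' \<in> carrier G" "b \<in> carrier G"
  shows "conjugate G a b \<otimes> conjugate G a' b = conjugate G a' b \<otimes> conjugate G a b"
  using assms by (simp add: conjugate_mult[symmetric])

lemma (in group) commutator_eq_inv_mult_conjugate:
  assumes "a \<in> carrier G" "b \<in> carrier G"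
  shows "commutator G a b = inv a \<otimes> conjugate G a b"
  using assms by (simp add: commutator_def conjugate_def m_assoc)

lemma (in group) commutator_eq_one_iff:
  assumes "a \<in> carrier G" "b \<in> carrier G"
  shows "commutator G a b = \<one> \<longleftrightarrow> a \<otimes> b = b \<otimes> a"
proof -
  have "commutator G a b = inv (b \<otimes> a) \<otimes> (a \<otimes> b)"
    using assms by (simp add: commutator_def inv_mult_group m_assoc)
  then show ?thesis
    using assms by (metis inv_closed inv_equality inv_inv l_inv m_closed)
qed

lemma (in group_hom) hom_conjugate:
  "a \<in> carrier G \<Longrightarrow> b \<in> carrier G \<Longrightarrow> h (conjugate G a b) = conjugate H (h a) (h b)"
  by (simp add: conjugate_def)

lemma (in group_hom) hom_commutator:
  "a \<in> carrier G \<Longrightarrow> b \<in> carrier G \<Longrightarrow> h (commutator G a b) = commutator H (h a) (h b)"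
  by (simp add: commutator_def)

lemma (in group) commute_inv:
  assumes "a \<otimes> b = b \<otimes> a" "a \<in> carrier G" "b \<in> carrier G"
  shows "inv a \<otimes> b = b \<otimes> inv a"
  using assms by (metis inv_closed inv_solve_left inv_solve_right m_assoc m_closed)

lemma (in group) commute_mult:
  assumes "a \<otimes> b = b \<otimes> a" "a' \<otimes> b = b \<otimes> a'"
    and "a \<in> carrier G" "a' \<in> carrier G" "b \<in> carrier G"
  shows "(a \<otimes> a') \<otimes> b = b \<otimes> (a \<otimes> a')"
  using assms by (metis m_assoc)

lemma (in group) commute_pow:
  assumes "a \<otimes> b = b \<otimes> a" "a \<in> carrier G" "b \<in> carrier G"
  shows "a [^] (n :: nat) \<otimes> b = b \<otimes> a [^] n"
  using assms by (induction n) (simp_all add: commute_mult)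

lemma (in group) pow_eq_one_mono:
  fixes p :: nat
  assumes "a [^] (p ^ m) = \<one>" "m \<le> n" "a \<in> carrier G"
  shows "a [^] (p ^ n) = \<one>"
proof -
  have "p ^ n = p ^ m * p ^ (n - m)" using assms(2) by (simp add: power_add[symmetric])
  then show ?thesis using assms by (metis nat_pow_pow nat_pow_one)
qed

lemma (in group) subgroup_nat_pow_mem:
  "subgroup H G \<Longrightarrow> a \<in> H \<Longrightarrow> a [^] (n :: nat) \<in> H"
  by (metis int_pow_int subgroup_int_pow_closed)

text \<open>
  Modulo a normal subgroup, centralizers are subgroups. So two subgroups commute modulo \<open>P\<close> as
  soon as their generators do.
\<close>

lemma (in group) commutator_generate_mem_normal:
  assumes P: "P \<lhd> G" and A: "A \<subseteq> carrier G" and B: "B \<subseteq> carrier G"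
    and AB: "\<And>a b. a \<in> A \<Longrightarrow> b \<in> B \<Longrightarrow> commutator G a b \<in> P"
    and a: "a \<in> generate G A" and b: "b \<in> generate G B"
  shows "commutator G a b \<in> P"
proof -
  interpret P: normal P G by fact
  interpret Q: group_hom G "G Mod P" "\<lambda>a. P #> a"
    by (simp add: group_hom_def group_hom_axioms_def is_group P.factorgroup_is_group
        P.r_coset_hom_Mod)
  have mem_iff: "commutator G a b \<in> P \<longleftrightarrow>
      (P #> a) \<otimes>\<^bsub>G Mod P\<^esub> (P #> b) = (P #> b) \<otimes>\<^bsub>G Mod P\<^esub> (P #> a)"
    if "a \<in> carrier G" "b \<in> carrier G" for a b
  proof -
    have "commutator G a b \<in> P \<longleftrightarrow> P #> commutator G a b = \<one>\<^bsub>G Mod P\<^esub>"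
      using that P.rcos_const[OF is_group] rcos_self[OF _ P.subgroup_axioms]
      by (metis commutator_closed one_FactGroup)
    then show ?thesis
      using that by (metis Q.hom_commutator Q.H.commutator_eq_one_iff Q.hom_closed)
  qed
  let ?comm = "\<lambda>a b. (P #> a) \<otimes>\<^bsub>G Mod P\<^esub> (P #> b) = (P #> b) \<otimes>\<^bsub>G Mod P\<^esub> (P #> a)"
  have generators: "?comm a b" if "a \<in> generate G A" "b \<in> B" for a b
    using that
  proof (induction rule: generate.induct)
    case one
    then show ?case using B by (metis Q.H.l_one Q.H.r_one Q.hom_closed Q.hom_one subsetD)
  next
    case (incl h)
    then show ?case using A B AB mem_iff by blast
  next
    case (inv h)
    then have "?comm h b" "h \<in> carrier G" "b \<in> carrier G"
      using A B AB mem_iff by blast+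
    then show ?case using Q.H.commute_inv[of "P #> h" "P #> b"] by simp
  next
    case (eng h h')
    then have "h \<in> carrier G" "h' \<in> carrier G" "b \<in> carrier G"
      using generate_in_carrier[OF A] B by auto
    then show ?case using eng Q.H.commute_mult[of "P #> h" "P #> b" "P #> h'"] by simp
  qed
  have "?comm b a" using b
  proof (induction rule: generate.induct)
    case one
    then show ?case using a generate_in_carrier[OF A]
      by (metis Q.H.l_one Q.H.r_one Q.hom_closed Q.hom_one)
  next
    case (incl h)
    show ?case by (rule sym) (rule generators[OF a incl])
  next
    case (inv h)
    then have "?comm h a" "h \<in> carrier G" "a \<in> carrier G"
      using a B generators generate_in_carrier[OF A] by auto
    then show ?case using Q.H.commute_inv[of "P #> h" "P #> a"] by simp
  next
    case (eng h h')
    then have "h \<in> carrier G" "h' \<in> carrier G" "a \<in> carrier G"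
      using generate_in_carrier A B a by auto
    then show ?case using eng Q.H.commute_mult[of "P #> h" "P #> a" "P #> h'"] by simp
  qed
  then show ?thesis
    using mem_iff[of a b] a b generate_in_carrier A B by simp
qed

lemma (in group) commute_generate:
  assumes S: "S \<subseteq> carrier G" and comm: "\<And>a b. a \<in> S \<Longrightarrow> b \<in> S \<Longrightarrow> a \<otimes> b = b \<otimes> a"
    and "a \<in> generate G S" "b \<in> generate G S"
  shows "a \<otimes> b = b \<otimes> a"
proof -
  have "commutator G a b \<in> {\<one>}"
    by (rule commutator_generate_mem_normal[OF one_is_normal S S])
      (use assms in \<open>auto simp: commutator_eq_one_iff subset_iff\<close>)
  then show ?thesis
    using assms generate_in_carrier[OF S] by (simp add: commutator_eq_one_iff)
qed

lemma (in group) derived_subset_if_commutators: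
  assumes P: "P \<lhd> G" and H: "subgroup H G"
    and comm: "\<And>a b. a \<in> H \<Longrightarrow> b \<in> H \<Longrightarrow> commutator G a b \<in> P"
  shows "derived G H \<subseteq> P"
proof -
  have "a \<otimes> b \<otimes> inv a \<otimes> inv b \<in> P" if "a \<in> H" "b \<in> H" for a b
    using comm[of "inv a" "inv b"] that subgroup.m_inv_closed[OF H]
      subgroup.mem_carrier[OF H] by (simp add: commutator_def)
  then show ?thesis
    unfolding derived_def using P normal_imp_subgroup
    by (intro generate_subgroup_incl) auto
qed

lemma (in group) commutator_mem_derived:
  assumes H: "subgroup H G" and "a \<in> H" "b \<in> H"
  shows "commutator G a b \<in> derived G H"
proof -
  have "commutator G a b = inv a \<otimes> inv b \<otimes> inv (inv a) \<otimes> inv (inv b)"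
    using assms subgroup.mem_carrier[OF H] by (simp add: commutator_def)
  then show ?thesis
    unfolding derived_def using assms subgroup.m_inv_closed[OF H]
    by (intro generate.incl) blast
qed

text \<open>
  Conjugation by a generator and by its inverse both have to be controlled: conjugation by one
  element can map a subgroup properly into itself, as \<open>x\<^sup>t = x\<^sup>p\<close> allows for \<open>\<langle>x\<rangle>\<close>.
\<close>

lemma (in group) generate_normal_if_generators:
  assumes A: "A \<subseteq> carrier G" "generate G A = carrier G" and S: "S \<subseteq> carrier G"
    and conj: "\<And>a s. a \<in> A \<Longrightarrow> s \<in> S \<Longrightarrow> conjugate G s a \<in> generate G S"
    and conj_inv: "\<And>a s. a \<in> A \<Longrightarrow> s \<in> S \<Longrightarrow> conjugate G s (inv a) \<in> generate G S"
  shows "generate G S \<lhd> G"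
proof -
  have sub: "subgroup (generate G S) G" using S by (rule generate_is_subgroup)
  have extend: "conjugate G h g \<in> generate G S"
    if g: "g \<in> carrier G" and gS: "\<And>s. s \<in> S \<Longrightarrow> conjugate G s g \<in> generate G S"
      and h: "h \<in> generate G S" for g h
    using h
  proof (induction rule: generate.induct)
    case one
    then show ?case using g by (simp add: conjugate_def generate.one)
  next
    case (incl h)
    then show ?case using gS by blast
  next
    case (inv h)
    then show ?case
      using gS S g by (auto simp: conjugate_inv subgroup.m_inv_closed[OF sub])
  next
    case (eng h h')
    then show ?case
      using g generate_in_carrier[OF S] by (simp add: conjugate_mult generate.eng)
  qed
  have "\<forall>h\<in>generate G S. conjugate G h g \<in> generate G S" if "g \<in> generate G A" for g
    using that
  proof (induction rule: generate.induct)
    case one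
    then show ?case using generate_in_carrier[OF S] by simp
  next
    case (incl a)
    then show ?case using A extend conj by auto
  next
    case (inv a)
    then show ?case using A extend conj_inv by auto
  next
    case (eng g g')
    then show ?case
      using generate_in_carrier[OF A(1)] generate_in_carrier[OF S]
      by (metis conjugate_conjugate)
  qed
  then have "g \<otimes> h \<otimes> inv g \<in> generate G S"
    if "g \<in> carrier G" "h \<in> generate G S" for g h
    using that A(2) inv_closed[of g] by (fastforce simp: conjugate_def)
  then show ?thesis using sub by (simp add: normal_inv_iff)
qed


section \<open>The derived series of a group with these relations\<close>

text \<open>
  A group satisfying the defining relations and generated by \<open>x\<close>, \<open>y\<close>, \<open>t\<close>, that is, a quotient of
  \<open>G_group p\<close>. The bound on the derived length and the iterated identity follow from this alone.
\<close>

locale G_relations = group G for G (structure) +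
  fixes x y t :: 'a and p :: nat
  assumes gens_closed [simp]: "x \<in> carrier G" "y \<in> carrier G" "t \<in> carrier G"
    and generators: "generate G {x, y, t} = carrier G"
    and conjugate_x_t: "conjugate G x t = x [^] p"
    and conjugate_y_inv_t: "conjugate G y (inv t) = y [^] p"
    and commute_x_y: "x \<otimes> y = y \<otimes> x"
    and commutator_commutes: "\<And>(i :: int) (j :: int).
      commutator G (commutator G x (conjugate G (y [^] j) (t [^] i))) x = \<one>"
begin

text \<open>
  The opposite signs make both families sequences of roots in the same direction:
  \<open>x_root i\<close> and \<open>y_root i\<close> are \<open>p\<close>-th powers of \<open>x_root (i + 1)\<close> and \<open>y_root (i + 1)\<close>.
\<close>

definition x_root :: "int \<Rightarrow> 'a" where
  "x_root i = conjugate G x (t [^] (- i))"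

definition y_root :: "int \<Rightarrow> 'a" where
  "y_root j = conjugate G y (t [^] j)"

lemma x_root_closed [simp]: "x_root i \<in> carrier G"
  by (simp add: x_root_def)

lemma y_root_closed [simp]: "y_root i \<in> carrier G"
  by (simp add: y_root_def)

lemma x_root_0: "x_root 0 = x" and y_root_0: "y_root 0 = y"
  by (simp_all add: x_root_def y_root_def)

lemma conjugate_x_root: "conjugate G (x_root i) (t [^] k) = x_root (i - k)"
  and conjugate_y_root: "conjugate G (y_root i) (t [^] k) = y_root (i + k)" for k :: int
  by (simp_all add: x_root_def y_root_def conjugate_conjugate int_pow_mult[symmetric])

lemma conjugate_x_root_t: "conjugate G (x_root i) t = x_root (i - 1)"
  and conjugate_x_root_inv_t: "conjugate G (x_root i) (inv t) = x_root (i + 1)"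
  and conjugate_y_root_t: "conjugate G (y_root i) t = y_root (i + 1)"
  and conjugate_y_root_inv_t: "conjugate G (y_root i) (inv t) = y_root (i - 1)"
  using conjugate_x_root[of i 1] conjugate_x_root[of i "- 1"]
    conjugate_y_root[of i 1] conjugate_y_root[of i "- 1"]
  by (simp_all add: int_pow_neg)

lemma x_root_pow_p: "x_root i [^] p = x_root (i - 1)"
proof -
  have "x_root i [^] p = conjugate G (conjugate G x t) (t [^] (- i))"
    by (simp add: x_root_def conjugate_nat_pow conjugate_x_t)
  then show ?thesis
    using conjugate_x_root_t[of 0] conjugate_x_root[of "- 1" "- i"] by (simp add: x_root_0)
qed

lemma y_root_pow_p: "y_root j [^] p = y_root (j - 1)"
proof -
  have "y_root j [^] p = conjugate G (conjugate G y (inv t)) (t [^] j)"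
    by (simp add: y_root_def conjugate_nat_pow conjugate_y_inv_t)
  then show ?thesis
    using conjugate_y_root_inv_t[of 0] conjugate_y_root[of "- 1" j]
    by (simp add: y_root_0)
qed

lemma x_root_pow: "x_root i [^] (p ^ m) = x_root (i - int m)"
proof (induction m)
  case (Suc m)
  have "x_root i [^] (p ^ Suc m) = (x_root i [^] (p ^ m)) [^] p"
    by (simp add: nat_pow_pow mult.commute)
  then show ?case using Suc x_root_pow_p by (simp add: algebra_simps)
qed simp

lemma y_root_pow: "y_root i [^] (p ^ m) = y_root (i - int m)"
proof (induction m)
  case (Suc m)
  have "y_root i [^] (p ^ Suc m) = (y_root i [^] (p ^ m)) [^] p"
    by (simp add: nat_pow_pow mult.commute)
  then show ?case using Suc y_root_pow_p by (simp add: algebra_simps)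
qed simp

lemma x_root_eq_pow: "i \<le> m \<Longrightarrow> x_root i = x_root m [^] (p ^ nat (m - i))"
  by (simp add: x_root_pow)

lemma y_root_eq_pow: "i \<le> m \<Longrightarrow> y_root i = y_root m [^] (p ^ nat (m - i))"
  by (simp add: y_root_pow)

lemma commute_y_root: "y_root i \<otimes> y_root j = y_root j \<otimes> y_root i"
  using y_root_eq_pow[of i "max i j"] y_root_eq_pow[of j "max i j"]
  by (simp add: nat_pow_mult add.commute)

text \<open>
  Conjugation by \<open>t\<^sup>j\<close> takes \<open>x_root (i + j)\<close> and \<open>y\<close> to the two elements in question. For
  \<open>i + j \<le> 0\<close> the former is a power of \<open>x\<close>, and \<open>x\<close> commutes with \<open>y\<close>.
\<close>

lemma commute_x_root_y_root:
  assumes "i + j \<le> 0"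
  shows "x_root i \<otimes> y_root j = y_root j \<otimes> x_root i"
proof -
  have "x_root (i + j) = x [^] (p ^ nat (- (i + j)))"
    using assms x_root_pow[of 0 "nat (- (i + j))"] by (simp add: x_root_0 add.commute)
  then have "x_root (i + j) \<otimes> y = y \<otimes> x_root (i + j)"
    by (simp add: commute_pow commute_x_y)
  from conjugate_commute[OF this, of "t [^] j"]
  show ?thesis using conjugate_x_root[of "i + j" j] by (simp add: y_root_def)
qed

text \<open>
  All powers of all \<open>y_root j\<close>. They form an increasing union of cyclic groups, the image of \<open>\<int>[1/p]\<close>.
\<close>

definition y_line :: "'a set" where
  "y_line = {y_root j [^] k | (j :: int) (k :: int). True}"

lemma y_line_closed: "v \<in> y_line \<Longrightarrow> v \<in> carrier G"
  by (auto simp: y_line_def)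

lemma y_root_mem_y_line: "y_root j \<in> y_line"
proof -
  have "y_root j = y_root j [^] (1 :: int)" by simp
  then show ?thesis unfolding y_line_def by blast
qed

lemma subgroup_y_line: "subgroup y_line G"
proof (rule subgroupI)
  show "y_line \<subseteq> carrier G" using y_line_closed by blast
  show "y_line \<noteq> {}" using y_root_mem_y_line by blast
next
  fix a assume "a \<in> y_line"
  then obtain j k where "a = y_root j [^] (k :: int)" by (auto simp: y_line_def)
  then have "inv a = y_root j [^] (- k)" by (simp add: int_pow_neg)
  then show "inv a \<in> y_line" by (auto simp: y_line_def)
next
  fix a b assume "a \<in> y_line" "b \<in> y_line"
  then obtain j k j' k' where a: "a = y_root j [^] (k :: int)" and b: "b = y_root j' [^] (k' :: int)"
    by (auto simp: y_line_def)
  define m where "m = max j j'"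
  have root: "\<exists>l :: int. y_root i [^] k = y_root m [^] l" if "i \<le> m" for i and k :: int
  proof -
    have "y_root i = y_root m [^] int (p ^ nat (m - i))"
      using that y_root_eq_pow[of i m] by (simp add: int_pow_int del: of_nat_power)
    then show ?thesis by (metis int_pow_pow y_root_closed)
  qed
  obtain l l' :: int where "a = y_root m [^] l" "b = y_root m [^] l'"
    using root[of j k] root[of j' k'] by (auto simp: a b m_def)
  then have "a \<otimes> b = y_root m [^] (l + l')" by (simp add: int_pow_mult)
  then show "a \<otimes> b \<in> y_line" by (auto simp: y_line_def)
qed

lemma conjugate_y_line:
  assumes "v \<in> y_line"
  shows "conjugate G v (t [^] (k :: int)) \<in> y_line"
  using assms by (fastforce simp: y_line_def conjugate_int_pow conjugate_y_root)

text \<open>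
  Since the elements of this set turn out to commute with each other and with \<open>x\<close>, the set is stable
  under conjugation by \<open>x\<close>, \<open>y\<close>, \<open>t\<close> and therefore contains every conjugate of \<open>x\<close> in the group.
\<close>

definition x_conjugates :: "'a set" where
  "x_conjugates = {conjugate G (x_root i) v | i v. v \<in> y_line}"

lemma x_conjugates_closed: "x_conjugates \<subseteq> carrier G"
  by (auto simp: x_conjugates_def y_line_closed)

lemma x_root_mem_x_conjugates: "x_root i \<in> x_conjugates"
proof -
  have "x_root i = conjugate G (x_root i) \<one>" by simp
  then show ?thesis
    unfolding x_conjugates_def using subgroup.one_closed[OF subgroup_y_line] by blast
qed

lemma commute_x_conjugate_x:
  assumes "v \<in> y_line"
  shows "conjugate G x v \<otimes> x = x \<otimes> conjugate G x v"
proof -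
  obtain i j :: int where v: "v = conjugate G (y [^] j) (t [^] i)"
    using assms by (auto simp: y_line_def y_root_def conjugate_int_pow)
  then have v_closed: "v \<in> carrier G" by simp
  have "commutator G x v \<otimes> x = x \<otimes> commutator G x v"
    using commutator_commutes[of j i] v_closed
    by (simp add: v commutator_eq_one_iff)
  then have "(x \<otimes> commutator G x v) \<otimes> x = x \<otimes> (x \<otimes> commutator G x v)"
    using v_closed by (simp add: commute_mult)
  then show ?thesis
    using v_closed by (simp add: commutator_eq_inv_mult_conjugate mult_inv_cancel_left)
qed

text \<open>
  Both roots are powers of \<open>x_root m\<close> with \<open>m = max i j\<close>, which reduces the claim to \<open>i = j = m\<close>. Then
  conjugation by \<open>t\<^sup>m\<close> turns \<open>x_root m\<close> into \<open>x\<close> and replaces \<open>v\<close> by another element of \<open>y_line\<close>.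
\<close>

lemma commute_x_root_conjugate_x_root:
  assumes v: "v \<in> y_line"
  shows "conjugate G (x_root i) v \<otimes> x_root j = x_root j \<otimes> conjugate G (x_root i) v"
proof -
  have v_closed: "v \<in> carrier G" using v by (rule y_line_closed)
  define m where "m = max i j"
  define u where "u = conjugate G v (t [^] m)"
  have u: "u \<in> y_line" using v by (simp add: u_def conjugate_y_line)
  have conj_u: "conjugate G u (t [^] (- m)) = v"
    using v_closed by (simp add: u_def conjugate_conjugate int_pow_mult[symmetric])
  have same: "conjugate G (x_root m) v \<otimes> x_root m = x_root m \<otimes> conjugate G (x_root m) v"
    using conjugate_commute[OF commute_x_conjugate_x[OF u], of "t [^] (- m)"]
      y_line_closed[OF u] conj_u
      conjugate_conjugate_swap[of x u "t [^] (- m)"] by (simp add: x_root_def)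
  have i: "x_root i = x_root m [^] (p ^ nat (m - i))"
    and j: "x_root j = x_root m [^] (p ^ nat (m - j))"
    using x_root_eq_pow[of i m] x_root_eq_pow[of j m] by (simp_all add: m_def)
  have "conjugate G (x_root i) v \<otimes> x_root m = x_root m \<otimes> conjugate G (x_root i) v"
    unfolding i using commute_pow[OF same] v_closed by (simp add: conjugate_nat_pow)
  then show ?thesis
    unfolding j using commute_pow[OF sym] v_closed by simp
qed

lemma commute_x_conjugates:
  assumes "a \<in> x_conjugates" "b \<in> x_conjugates"
  shows "a \<otimes> b = b \<otimes> a"
proof -
  obtain i v j u where a: "a = conjugate G (x_root i) v" and b: "b = conjugate G (x_root j) u"
    and v: "v \<in> y_line" and u: "u \<in> y_line"
    using assms by (auto simp: x_conjugates_def)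
  have "v \<otimes> inv u \<in> y_line"
    using subgroup_y_line u v by (simp add: subgroup.m_closed subgroup.m_inv_closed)
  from conjugate_commute[OF commute_x_root_conjugate_x_root[OF this, where i = i and j = j], of u]
  show ?thesis
    using y_line_closed u v by (simp add: a b conjugate_conjugate m_assoc)
qed

text \<open>
  The normal closure of \<open>x\<close>.
\<close>

definition K :: "'a set" where
  "K = generate G x_conjugates"

lemma K_commute: "a \<in> K \<Longrightarrow> b \<in> K \<Longrightarrow> a \<otimes> b = b \<otimes> a"
  unfolding K_def using x_conjugates_closed commute_x_conjugates by (rule commute_generate)

lemma K_closed: "a \<in> K \<Longrightarrow> a \<in> carrier G"
  unfolding K_def using x_conjugates_closed by (rule generate_in_carrier)

lemma subgroup_K: "subgroup K G"
  unfolding K_def using x_conjugates_closed by (rule generate_is_subgroup)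

lemma x_conjugates_subset_K: "x_conjugates \<subseteq> K"
  unfolding K_def by (auto intro: generate.incl)

lemma x_root_mem_K: "x_root i \<in> K"
  using x_root_mem_x_conjugates x_conjugates_subset_K by blast

lemma conjugate_x_conjugates_t:
  assumes "s \<in> x_conjugates"
  shows "conjugate G s (t [^] (k :: int)) \<in> x_conjugates"
proof -
  obtain i v where s: "s = conjugate G (x_root i) v" and v: "v \<in> y_line"
    using assms by (auto simp: x_conjugates_def)
  have "conjugate G s (t [^] k) = conjugate G (x_root (i - k)) (conjugate G v (t [^] k))"
    using y_line_closed[OF v]
    by (simp add: s conjugate_conjugate_swap[of "x_root i" v] conjugate_x_root)
  then show ?thesis using conjugate_y_line[OF v] by (auto simp: x_conjugates_def)
qed

lemma conjugate_x_conjugates_y_line: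
  assumes "s \<in> x_conjugates" and u: "u \<in> y_line"
  shows "conjugate G s u \<in> x_conjugates"
proof -
  obtain i v where s: "s = conjugate G (x_root i) v" and v: "v \<in> y_line"
    using assms by (auto simp: x_conjugates_def)
  have "conjugate G s u = conjugate G (x_root i) (v \<otimes> u)"
    using y_line_closed u v by (simp add: s conjugate_conjugate)
  then show ?thesis
    using subgroup.m_closed[OF subgroup_y_line v u] by (auto simp: x_conjugates_def)
qed

lemma normal_K: "K \<lhd> G"
  unfolding K_def
proof (rule generate_normal_if_generators[OF _ generators x_conjugates_closed])
  have x: "conjugate G s x = s" "conjugate G s (inv x) = s" if "s \<in> x_conjugates" for s
  proof -
    have s: "s \<in> K" "x \<in> K" "inv x \<in> K"
      using that x_conjugates_subset_K x_root_mem_K[of 0] subgroup.m_inv_closed[OF subgroup_K]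
      by (auto simp: x_root_0)
    then show "conjugate G s x = s" "conjugate G s (inv x) = s"
      by (simp_all add: conjugate_eq_self K_commute K_closed)
  qed
  have y: "y \<in> y_line" "inv y \<in> y_line"
    using y_root_mem_y_line[of 0] subgroup.m_inv_closed[OF subgroup_y_line]
    by (auto simp: y_root_0)
  have t: "conjugate G s t \<in> x_conjugates" "conjugate G s (inv t) \<in> x_conjugates"
    if "s \<in> x_conjugates" for s
    using conjugate_x_conjugates_t[OF that, of 1] conjugate_x_conjugates_t[OF that, of "- 1"]
    by (simp_all add: int_pow_neg)
  show "conjugate G s a \<in> generate G x_conjugates"
    "conjugate G s (inv a) \<in> generate G x_conjugates"
    if "a \<in> {x, y, t}" "s \<in> x_conjugates" for a s
    using that x t conjugate_x_conjugates_y_line y by (auto intro: generate.incl)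
qed simp

definition K_torsion :: "'a set" where
  "K_torsion = {a \<in> K. \<exists>m. a [^] (p ^ m) = \<one>}"

lemma normal_K_torsion: "K_torsion \<lhd> G"
proof -
  have "subgroup K_torsion G"
  proof (rule subgroupI)
    show "K_torsion \<subseteq> carrier G" by (auto simp: K_torsion_def K_closed)
    have "\<one> \<in> K_torsion"
      using subgroup.one_closed[OF subgroup_K] by (simp add: K_torsion_def)
    then show "K_torsion \<noteq> {}" by blast
  next
    fix a assume "a \<in> K_torsion"
    then show "inv a \<in> K_torsion"
      by (auto simp: K_torsion_def K_closed nat_pow_inv subgroup.m_inv_closed[OF subgroup_K])
  next
    fix a b assume a: "a \<in> K_torsion" and b: "b \<in> K_torsion"
    then obtain m n where "a [^] (p ^ m) = \<one>" "b [^] (p ^ n) = \<one>"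
      by (auto simp: K_torsion_def)
    then have "a [^] (p ^ max m n) = \<one>" "b [^] (p ^ max m n) = \<one>"
      using a b by (auto simp: K_torsion_def K_closed intro: pow_eq_one_mono)
    then have "(a \<otimes> b) [^] (p ^ max m n) = \<one>"
      using a b by (simp add: K_torsion_def K_closed K_commute pow_mult_distrib)
    then show "a \<otimes> b \<in> K_torsion"
      using a b subgroup.m_closed[OF subgroup_K] by (auto simp: K_torsion_def)
  qed
  moreover have "g \<otimes> a \<otimes> inv g \<in> K_torsion" if g: "g \<in> carrier G" and a: "a \<in> K_torsion" for g a
  proof -
    obtain m where "a [^] (p ^ m) = \<one>" using a by (auto simp: K_torsion_def)
    then have "conjugate G a (inv g) [^] (p ^ m) = \<one>"
      using a g by (simp add: K_torsion_def K_closed conjugate_nat_pow[symmetric])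
        (simp add: conjugate_def)
    then show ?thesis
      using a g normal_K by (auto simp: K_torsion_def conjugate_def normal_inv_iff)
  qed
  ultimately show ?thesis by (simp add: normal_inv_iff)
qed

text \<open>
  Powers of \<open>[x\<^sub>i, y\<^sub>j] = x\<^sub>i\<inverse> x\<^sub>i\<^bsup>y\<^sub>j\<^esup>\<close> can be taken factor by factor in \<open>K\<close>. For \<open>m = i + j\<close>, the \<open>p\<^sup>m\<close>-th
  power is \<open>[x\<^sub>-\<^sub>j, y\<^sub>j] = 1\<close>. For \<open>i + j < 0\<close> the commutator itself is trivial, and \<open>m = 0\<close> will do.
\<close>

lemma commutator_x_root_y_root: "commutator G (x_root i) (y_root j) \<in> K_torsion"
proof -
  let ?c = "conjugate G (x_root i) (y_root j)"
  define m where "m = nat (i + j)"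
  have K: "inv (x_root i) \<in> K" "?c \<in> K"
    using x_root_mem_K subgroup.m_inv_closed[OF subgroup_K] x_conjugates_subset_K
      conjugate_x_conjugates_y_line[OF x_root_mem_x_conjugates y_root_mem_y_line] by auto
  have "?c [^] (p ^ m) = conjugate G (x_root (i - int m)) (y_root j)"
    by (simp add: conjugate_nat_pow[symmetric] x_root_pow)
  also have "\<dots> = x_root (i - int m)"
    by (simp add: conjugate_eq_self commute_x_root_y_root m_def)
  finally have "(inv (x_root i) \<otimes> ?c) [^] (p ^ m) = \<one>"
    using K by (simp add: pow_mult_distrib K_commute nat_pow_inv x_root_pow)
  then show ?thesis
    using K subgroup.m_closed[OF subgroup_K]
    by (auto simp: commutator_eq_inv_mult_conjugate K_torsion_def)
qed

text \<open>
  The normal closure of \<open>x\<close> and \<open>y\<close>, generated by roots in order that its commutators can be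
  computed modulo \<open>K_torsion\<close> on generators.
\<close>

definition N :: "'a set" where
  "N = generate G (range x_root \<union> range y_root)"

lemma roots_closed: "range x_root \<union> range y_root \<subseteq> carrier G"
  by auto

lemma subgroup_N: "subgroup N G"
  unfolding N_def using roots_closed by (rule generate_is_subgroup)

lemma x_root_mem_N: "x_root i \<in> N" and y_root_mem_N: "y_root i \<in> N"
  by (auto simp: N_def intro: generate.incl)

lemma normal_N: "N \<lhd> G"
  unfolding N_def
proof (rule generate_normal_if_generators[OF _ generators roots_closed])
  fix a s assume a: "a \<in> {x, y, t}" and s: "s \<in> range x_root \<union> range y_root"
  have xy: "conjugate G s b \<in> N" if "b \<in> N" for b
    using that s x_root_mem_N y_root_mem_N subgroup_N
    by (auto simp: conjugate_def subgroup.m_closed subgroup.m_inv_closed)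
  have t: "conjugate G s t \<in> N" "conjugate G s (inv t) \<in> N"
    using s x_root_mem_N y_root_mem_N
    by (auto simp: conjugate_x_root_t conjugate_x_root_inv_t
        conjugate_y_root_t conjugate_y_root_inv_t)
  have "x \<in> N" "y \<in> N" using x_root_mem_N[of 0] y_root_mem_N[of 0]
    by (simp_all add: x_root_0 y_root_0)
  then show "conjugate G s a \<in> generate G (range x_root \<union> range y_root)"
    "conjugate G s (inv a) \<in> generate G (range x_root \<union> range y_root)"
    using a xy t subgroup.m_inv_closed[OF subgroup_N] unfolding N_def[symmetric] by auto
qed simp

lemma commutator_mem_N:
  assumes "a \<in> carrier G" "b \<in> carrier G"
  shows "commutator G a b \<in> N"
proof (rule commutator_generate_mem_normal[OF normal_N])
  show "a \<in> generate G {x, y, t}" "b \<in> generate G {x, y, t}"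
    using assms by (simp_all add: generators)
next
  fix a b assume a: "a \<in> {x, y, t}" and b: "b \<in> {x, y, t}"
  have left: "commutator G c d \<in> N" if "c \<in> N" "d \<in> carrier G" for c d
    using that normal.inv_op_closed1[OF normal_N] subgroup.mem_carrier[OF subgroup_N]
      subgroup.m_closed[OF subgroup_N] subgroup.m_inv_closed[OF subgroup_N]
    by (simp add: commutator_eq_inv_mult_conjugate) (simp add: conjugate_def)
  have right: "commutator G d c \<in> N" if "c \<in> N" "d \<in> carrier G" for c d
  proof -
    have "commutator G d c = inv (commutator G c d)"
      using that subgroup.mem_carrier[OF subgroup_N]
      by (simp add: commutator_def inv_mult_group m_assoc)
    then show ?thesis using left[OF that] subgroup.m_inv_closed[OF subgroup_N] by simp
  qed
  have "x \<in> N" "y \<in> N" using x_root_mem_N[of 0] y_root_mem_N[of 0]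
    by (simp_all add: x_root_0 y_root_0)
  moreover have "commutator G t t \<in> N"
    using subgroup.one_closed[OF subgroup_N] by (simp add: commutator_eq_one_iff[THEN iffD2])
  ultimately show "commutator G a b \<in> N" using a b left right by auto
qed auto

lemma commutator_mem_K_torsion:
  assumes "a \<in> N" "b \<in> N"
  shows "commutator G a b \<in> K_torsion"
proof (rule commutator_generate_mem_normal[OF normal_K_torsion roots_closed roots_closed])
  show "a \<in> generate G (range x_root \<union> range y_root)"
    "b \<in> generate G (range x_root \<union> range y_root)"
    using assms by (simp_all add: N_def)
next
  have inv: "inv c \<in> K_torsion" if "c \<in> K_torsion" for c
    using that normal_K_torsion normal_imp_subgroup subgroup.m_inv_closed by fast
  have one: "\<one> \<in> K_torsion"
    using normal_K_torsion normal_imp_subgroup subgroup.one_closed by fast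
  have x: "commutator G (x_root i) (x_root j) = \<one>" for i j
    by (simp add: commutator_eq_one_iff K_commute x_root_mem_K)
  have y: "commutator G (y_root i) (y_root j) = \<one>" for i j
    by (simp add: commutator_eq_one_iff commute_y_root)
  have yx: "commutator G (y_root j) (x_root i) = inv (commutator G (x_root i) (y_root j))" for i j
    by (simp add: commutator_def inv_mult_group m_assoc)
  fix a b assume "a \<in> range x_root \<union> range y_root" "b \<in> range x_root \<union> range y_root"
  then show "commutator G a b \<in> K_torsion"
    using x y yx one inv commutator_x_root_y_root by auto
qed

text \<open>
  The derived series is bounded by \<open>N\<close>, \<open>K_torsion\<close> and \<open>1\<close>.
\<close>

lemma derived_3_trivial: "(derived G ^^ 3) (carrier G) = {\<one>}"
proof -
  have "derived G (carrier G) \<subseteq> N"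
    by (rule derived_subset_if_commutators[OF normal_N subgroup_self commutator_mem_N])
  moreover have "derived G N \<subseteq> K_torsion"
    by (rule derived_subset_if_commutators[OF normal_K_torsion subgroup_N commutator_mem_K_torsion])
  moreover have "derived G K_torsion \<subseteq> {\<one>}"
  proof (rule derived_subset_if_commutators[OF one_is_normal])
    show "subgroup K_torsion G" using normal_K_torsion by (rule normal_imp_subgroup)
    fix a b assume "a \<in> K_torsion" "b \<in> K_torsion"
    then show "commutator G a b \<in> {\<one>}"
      by (simp add: K_torsion_def commutator_eq_one_iff K_closed K_commute)
  qed
  ultimately have "derived G (derived G (derived G (carrier G))) \<subseteq> {\<one>}"
    by (meson mono_derived order_trans)
  moreover have "subgroup (derived G (derived G (derived G (carrier G)))) G"
    by (simp add: derived_is_subgroup derived_in_carrier)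
  ultimately show ?thesis
    using subgroup.one_closed by (fastforce simp: eval_nat_numeral)
qed

text \<open>
  The reason for the \<open>p\<close>-th power in \<open>w\<close>: on the abelian group \<open>K_torsion\<close>, the map
  \<open>u \<mapsto> [u, z]\<close> is a homomorphism, so it does not increase exponents, and the \<open>p\<close>-th power lowers them.
\<close>

lemma K_torsion_commutator_pow:
  assumes u: "u \<in> K_torsion" "u [^] (p ^ Suc m) = \<one>" and z: "z \<in> carrier G"
  shows "commutator G u z [^] p \<in> K_torsion" "(commutator G u z [^] p) [^] (p ^ m) = \<one>"
proof -
  have T: "subgroup K_torsion G" using normal_K_torsion by (rule normal_imp_subgroup)
  have K: "u \<in> K" "u \<in> carrier G" using u(1) by (auto simp: K_torsion_def K_closed)
  have conj: "conjugate G u z \<in> K_torsion"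
    using u z normal.inv_op_closed1[OF normal_K_torsion] by (simp add: conjugate_def)
  then have conj_K: "conjugate G u z \<in> K" by (simp add: K_torsion_def)
  show "commutator G u z [^] p \<in> K_torsion"
    using u conj subgroup.m_closed[OF T] subgroup.m_inv_closed[OF T] K z
    by (simp add: commutator_eq_inv_mult_conjugate subgroup_nat_pow_mem[OF T])
  have "conjugate G u z [^] (p ^ Suc m) = \<one>"
    using u K z by (simp add: conjugate_nat_pow[symmetric] del: power_Suc) (simp add: conjugate_def)
  then have "commutator G u z [^] (p ^ Suc m) = \<one>"
    using K conj_K z u
    by (simp add: commutator_eq_inv_mult_conjugate pow_mult_distrib nat_pow_inv
        K_commute subgroup.m_inv_closed[OF subgroup_K] del: power_Suc)
  then show "(commutator G u z [^] p) [^] (p ^ m) = \<one>"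
    using K z by (simp add: nat_pow_pow)
qed

end

section \<open>Evaluating words and mapping out of presentations\<close>

definition free_eval :: "('b, 'c) monoid_scheme \<Rightarrow> ('a \<Rightarrow> 'b) \<Rightarrow> 'a letter list \<Rightarrow> 'b" where
  "free_eval G f u =
     foldr (\<lambda>(a, s) z. (if s then f a else inv\<^bsub>G\<^esub> (f a)) \<otimes>\<^bsub>G\<^esub> z) u \<one>\<^bsub>G\<^esub>"

lemma word_value_eq_free_eval: "word_value G w g = free_eval G g w"
  by (simp add: word_value_def free_eval_def)

context group
begin

lemma free_eval_closed:
  assumes "f \<in> X \<rightarrow> carrier G" "fst ` set u \<subseteq> X"
  shows "free_eval G f u \<in> carrier G"
  using assms by (induction u) (auto simp: free_eval_def Pi_iff)

lemma free_eval_push_letter: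
  assumes "f \<in> X \<rightarrow> carrier G" "fst ` set (l # u) \<subseteq> X"
  shows "free_eval G f (push_letter l u) = free_eval G f (l # u)"
proof (cases u)
  case (Cons k v)
  have "f (fst l) \<in> carrier G" using assms by auto
  moreover have "free_eval G f v \<in> carrier G"
    using assms by (intro free_eval_closed[of f X]) (auto simp: Cons)
  ultimately show ?thesis
    by (cases l) (auto simp: Cons free_eval_def inv_letter_def inv_mult_cancel_left
        mult_inv_cancel_left)
qed (simp add: free_eval_def)

lemma free_eval_foldr_push_letter:
  assumes f: "f \<in> X \<rightarrow> carrier G" and "fst ` set u \<subseteq> X" "fst ` set v \<subseteq> X"
  shows "free_eval G f (foldr push_letter u v) = free_eval G f u \<otimes> free_eval G f v"
  using assms(2)
proof (induction u)
  case Nil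
  then show ?case using free_eval_closed[OF f assms(3)] by (simp add: free_eval_def)
next
  case (Cons l u)
  have "fst ` set (l # foldr push_letter u v) \<subseteq> X"
    using Cons.prems assms(3) set_foldr_push_letter[of u v] by force
  then have "free_eval G f (foldr push_letter (l # u) v)
      = free_eval G f (l # foldr push_letter u v)"
    using free_eval_push_letter[OF f] by simp
  also have "\<dots> = free_eval G f [l] \<otimes> (free_eval G f u \<otimes> free_eval G f v)"
    using Cons f by (auto simp: free_eval_def Pi_iff split: prod.splits)
  also have "\<dots> = free_eval G f (l # u) \<otimes> free_eval G f v"
    using Cons.prems f free_eval_closed[OF f assms(3)] free_eval_closed[OF f, of u]
    by (cases l) (auto simp: free_eval_def Pi_iff m_assoc)
  finally show ?case .
qed

lemma group_hom_free_eval: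
  assumes "f \<in> X \<rightarrow> carrier G"
  shows "group_hom (free_group X) G (free_eval G f)"
  unfolding group_hom_def group_hom_axioms_def
  using group_free_group is_group free_eval_closed[OF assms] free_eval_foldr_push_letter[OF assms]
  by (auto simp: hom_def free_group_def)

lemma free_eval_free_gen: "f a \<in> carrier G \<Longrightarrow> free_eval G f (free_gen a) = f a"
  by (simp add: free_eval_def free_gen_def)

end

lemma inv_free_gen:
  assumes "a \<in> X"
  shows "inv\<^bsub>free_group X\<^esub> (free_gen a) = [(a, False)]"
  by (rule group.inv_equality[OF group_free_group])
    (use assms in \<open>simp_all add: free_group_def free_gen_def inv_letter_def reduced_Cons\<close>)

lemma generate_free_gen: "generate (free_group X) (free_gen ` X) = carrier (free_group X)"
proof
  show "generate (free_group X) (free_gen ` X) \<subseteq> carrier (free_group X)"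
    by (rule group.generate_incl[OF group_free_group]) (auto intro: free_gen_carrier)
  show "carrier (free_group X) \<subseteq> generate (free_group X) (free_gen ` X)"
  proof
    fix u assume "u \<in> carrier (free_group X)"
    then show "u \<in> generate (free_group X) (free_gen ` X)"
    proof (induction u)
      case Nil
      then show ?case using generate.one[of "free_group X"] by (simp add: free_group_def)
    next
      case (Cons l u)
      obtain a s where l: "l = (a, s)" by (cases l)
      have a: "a \<in> X" and u: "u \<in> carrier (free_group X)" "reduced (l # u)"
        using Cons.prems by (auto simp: free_group_def l reduced_Cons)
      have "[l] \<in> generate (free_group X) (free_gen ` X)"
      proof (cases s)
        case True
        then show ?thesis using a by (auto simp: l free_gen_def intro!: generate.incl)
      next
        case False
        then show ?thesis
          using generate.inv[of "free_gen a" "free_gen ` X" "free_group X"] a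
          by (simp add: l inv_free_gen)
      qed
      moreover have "[l] \<otimes>\<^bsub>free_group X\<^esub> u = l # u"
        using u(2) by (cases u) (auto simp: free_group_def reduced_Cons)
      ultimately show ?case using generate.eng Cons.IH u(1) by metis
    qed
  qed
qed

lemma (in group) normal_normal_closure:
  assumes "R \<subseteq> carrier G"
  shows "normal_closure G R \<lhd> G"
proof -
  let ?\<N> = "{N. N \<lhd> G \<and> R \<subseteq> N}"
  have "carrier G \<in> ?\<N>" using assms normal_self by simp
  then have "subgroup (\<Inter>?\<N>) G"
    by (intro subgroups_Inter) (auto intro: normal_imp_subgroup)
  then show ?thesis
    unfolding normal_closure_def by (auto simp: normal_inv_iff)
qed

locale presentation =
  fixes X :: "'a set" and R :: "('a letter list \<times> 'a letter list) set"
  assumes relations_closed: "(u, v) \<in> R \<Longrightarrow> u \<in> carrier (free_group X) \<and> v \<in> carrier (free_group X)"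
begin

definition relators :: "'a letter list set" where
  "relators = {u \<otimes>\<^bsub>free_group X\<^esub> inv\<^bsub>free_group X\<^esub> v | u v. (u, v) \<in> R}"

definition proj :: "'a letter list \<Rightarrow> 'a letter list set" where
  "proj u = normal_closure (free_group X) relators #>\<^bsub>free_group X\<^esub> u"

sublocale F: group "free_group X"
  by (rule group_free_group)

lemma presented_group_eq:
  "presented_group X R = free_group X Mod normal_closure (free_group X) relators"
  by (simp add: presented_group_def relators_def)

sublocale N: normal "normal_closure (free_group X) relators" "free_group X"
  by (rule F.normal_normal_closure) (auto simp: relators_def dest: relations_closed)

sublocale proj: group_hom "free_group X" "presented_group X R" proj
  using N.r_coset_hom_Mod N.factorgroup_is_group F.is_group
  by (simp add: group_hom_def group_hom_axioms_def presented_group_eq proj_def[abs_def])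

lemma proj_surj: "proj ` carrier (free_group X) = carrier (presented_group X R)"
  by (auto simp: proj_def presented_group_eq FactGroup_def RCOSETS_def)

lemma generate_proj:
  "generate (presented_group X R) ((\<lambda>a. proj (free_gen a)) ` X) = carrier (presented_group X R)"
proof -
  have "(\<lambda>a. proj (free_gen a)) ` X = proj ` free_gen ` X" by auto
  moreover have "generate (presented_group X R) (proj ` free_gen ` X)
      = proj ` generate (free_group X) (free_gen ` X)"
    by (rule proj.generate_img) (auto intro: free_gen_carrier)
  ultimately show ?thesis
    by (simp add: generate_free_gen proj_surj)
qed

lemma proj_relation:
  assumes "(u, v) \<in> R"
  shows "proj u = proj v"
proof -
  have uv: "u \<in> carrier (free_group X)" "v \<in> carrier (free_group X)"
    using relations_closed[OF assms] by auto
  have "u \<otimes>\<^bsub>free_group X\<^esub> inv\<^bsub>free_group X\<^esub> v \<in> normal_closure (free_group X) relators"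
    using assms by (auto simp: normal_closure_def relators_def)
  then have "proj (u \<otimes>\<^bsub>free_group X\<^esub> inv\<^bsub>free_group X\<^esub> v) = \<one>\<^bsub>presented_group X R\<^esub>"
    using N.rcos_const[OF F.is_group] by (simp add: proj_def presented_group_eq)
  then have "proj u \<otimes>\<^bsub>presented_group X R\<^esub> inv\<^bsub>presented_group X R\<^esub> proj v
      = \<one>\<^bsub>presented_group X R\<^esub>"
    using uv by simp
  then show ?thesis
    using uv proj.H.inv_equality proj.H.inv_inv by (metis proj.H.inv_closed proj.hom_closed)
qed

lemma universal_property:
  assumes H: "group H" and f: "f \<in> X \<rightarrow> carrier H"
    and rel: "\<And>u v. (u, v) \<in> R \<Longrightarrow> free_eval H f u = free_eval H f v"
  obtains h where "group_hom (presented_group X R) H h"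
    and "\<And>a. a \<in> X \<Longrightarrow> h (proj (free_gen a)) = f a"
proof -
  interpret ev: group_hom "free_group X" H "free_eval H f"
    using H f by (rule group.group_hom_free_eval)
  have "relators \<subseteq> kernel (free_group X) H (free_eval H f)"
    using rel relations_closed by (auto simp: relators_def kernel_def)
  then have "normal_closure (free_group X) relators \<subseteq> kernel (free_group X) H (free_eval H f)"
    using ev.normal_kernel by (auto simp: normal_closure_def)
  then obtain h where "h \<in> hom (free_group X Mod normal_closure (free_group X) relators) H"
    and h: "\<And>u. u \<in> carrier (free_group X) \<Longrightarrow> h (proj u) = free_eval H f u"
    using ev.FactGroup_universal_kernel[OF N.normal_axioms] unfolding proj_def by metis
  then have "group_hom (presented_group X R) H h"
    using H proj.H.is_group
    by (simp add: group_hom_def group_hom_axioms_def presented_group_eq)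
  moreover have "h (proj (free_gen a)) = f a" if "a \<in> X" for a
    using h[OF free_gen_carrier[OF that]] group.free_eval_free_gen[OF H, of f a] Pi_mem[OF f that]
    by simp
  ultimately show ?thesis using that by blast
qed

end

text \<open>
  For the projection onto \<open>G_group p\<close> this yields the relations in the presented group from the
  pairs of words; for an evaluation in another group it yields the agreement on pairs of words
  from the relations.
\<close>

lemma hom_relations_iff:
  fixes p :: nat
  assumes "group_hom (free_group UNIV) H h"
  defines "x \<equiv> h (free_gen gen_x)" and "y \<equiv> h (free_gen gen_y)" and "t \<equiv> h (free_gen gen_t)"
  shows "(\<forall>(u, v) \<in> relations p. h u = h v) \<longleftrightarrow>
    conjugate H x t = x [^]\<^bsub>H\<^esub> p \<and> conjugate H y (inv\<^bsub>H\<^esub> t) = y [^]\<^bsub>H\<^esub> p \<and>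
    commutator H x y = \<one>\<^bsub>H\<^esub> \<and>
    (\<forall>(i :: int) (j :: int). commutator H
      (commutator H x (conjugate H (y [^]\<^bsub>H\<^esub> j) (t [^]\<^bsub>H\<^esub> i))) x = \<one>\<^bsub>H\<^esub>)"
proof -
  interpret group_hom "free_group UNIV" H h by fact
  have [simp]: "free_gen a \<in> carrier (free_group UNIV)" for a :: generator
    by (simp add: free_gen_carrier)
  let ?F = "free_group (UNIV :: generator set)"
  let ?x = "free_gen gen_x" and ?y = "free_gen gen_y" and ?t = "free_gen gen_t"
  have "(\<forall>(u, v) \<in> relations p. h u = h v) \<longleftrightarrow>
    h (conjugate ?F ?x ?t) = h (?x [^]\<^bsub>?F\<^esub> p) \<and>
    h (conjugate ?F ?y (inv\<^bsub>?F\<^esub> ?t)) = h (?y [^]\<^bsub>?F\<^esub> p) \<and>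
    h (commutator ?F ?x ?y) = h \<one>\<^bsub>?F\<^esub> \<and>
    (\<forall>(i :: int) (j :: int). h (commutator ?F
      (commutator ?F ?x (conjugate ?F (?y [^]\<^bsub>?F\<^esub> j) (?t [^]\<^bsub>?F\<^esub> i))) ?x) = h \<one>\<^bsub>?F\<^esub>)"
    unfolding relations_def Let_def by blast
  then show ?thesis
    by (simp add: x_def y_def t_def hom_conjugate hom_commutator hom_nat_pow hom_int_pow)
qed

lemma presentation_relations: "presentation UNIV (relations p)"
proof
  interpret F: group "free_group (UNIV :: generator set)" by (rule group_free_group)
  have [simp]: "free_gen a \<in> carrier (free_group UNIV)" for a :: generator
    by (simp add: free_gen_carrier)
  fix u v assume "(u, v) \<in> relations p"
  then show "u \<in> carrier (free_group UNIV) \<and> v \<in> carrier (free_group UNIV)"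
    by (auto simp: relations_def Let_def)
qed

interpretation presentation UNIV "relations p" for p
  by (rule presentation_relations)

lemma G_relations_G_group:
  "G_relations (G_group p) (proj p (free_gen gen_x)) (proj p (free_gen gen_y))
     (proj p (free_gen gen_t)) p"
proof -
  let ?x = "proj p (free_gen gen_x)" and ?y = "proj p (free_gen gen_y)"
    and ?t = "proj p (free_gen gen_t)"
  interpret group "G_group p" unfolding G_group_def by (rule proj.H.is_group)
  have closed: "?x \<in> carrier (G_group p)" "?y \<in> carrier (G_group p)" "?t \<in> carrier (G_group p)"
    by (auto simp: G_group_def intro: proj.hom_closed free_gen_carrier)
  have UNIV_eq: "UNIV = {gen_x, gen_y, gen_t}"
    using generator.exhaust by blast
  have "range (\<lambda>a. proj p (free_gen a)) = {?x, ?y, ?t}"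
    unfolding UNIV_eq by simp
  then have "generate (G_group p) {?x, ?y, ?t} = carrier (G_group p)"
    using generate_proj[of p] by (simp add: G_group_def)
  moreover have "\<forall>(u, v) \<in> relations p. proj p u = proj p v"
    using proj_relation by blast
  note this[unfolded hom_relations_iff[OF proj.group_hom_axioms]]
  ultimately show ?thesis
    using closed commutator_eq_one_iff[OF closed(1,2)]
    unfolding G_group_def[symmetric] by unfold_locales auto
qed

section \<open>The iterated word\<close>

context group
begin

lemma word_value_w_word:
  assumes "g \<in> {1..3} \<rightarrow> carrier G"
  shows "word_value G (w_word p) g = commutator G (g 1) (commutator G (g 2) (g 3)) [^] p"
proof -
  interpret ev: group_hom "free_group {1..3 :: nat}" G "free_eval G g"
    using assms by (rule group_hom_free_eval)
  have gen: "free_gen i \<in> carrier (free_group {1..3})" "free_eval G g (free_gen i) = g i"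
    if "i \<in> {1..3}" for i
    using that assms by (auto intro: free_gen_carrier free_eval_free_gen)
  show ?thesis
    using gen[of 1] gen[of 2] gen[of 3]
    by (simp add: word_value_eq_free_eval w_word_def Let_def ev.hom_nat_pow ev.hom_commutator
        del: One_nat_def)
qed

lemma iterated_value_w_word_closed:
  assumes "g \<in> {1..3} \<rightarrow> carrier G"
  shows "iterated_value G (w_word p) j g \<in> carrier G"
proof (induction j)
  case 0
  then show ?case using assms by (auto simp: word_value_w_word Pi_iff)
next
  case (Suc j)
  then have "g(1 := iterated_value G (w_word p) j g) \<in> {1..3} \<rightarrow> carrier G"
    using assms by auto
  moreover have "g 2 \<in> carrier G" "g 3 \<in> carrier G" using assms by auto
  ultimately show ?case using Suc by (simp add: word_value_w_word)
qed

lemma iterated_value_w_word_0: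
  assumes "g \<in> {1..3} \<rightarrow> carrier G"
  shows "iterated_value G (w_word p) 0 g = commutator G (g 1) (commutator G (g 2) (g 3)) [^] p"
  using assms by (simp add: word_value_w_word)

lemma iterated_value_w_word_Suc:
  assumes "g \<in> {1..3} \<rightarrow> carrier G"
  shows "iterated_value G (w_word p) (Suc j) g =
    commutator G (iterated_value G (w_word p) j g) (commutator G (g 2) (g 3)) [^] p"
proof -
  have "g(1 := iterated_value G (w_word p) j g) \<in> {1..3} \<rightarrow> carrier G"
    using assms iterated_value_w_word_closed[OF assms] by auto
  then show ?thesis by (simp add: word_value_w_word)
qed

end

lemma (in group_hom) hom_iterated_value_w_word:
  assumes "g \<in> {1..3} \<rightarrow> carrier G"
  shows "h (iterated_value G (w_word p) j g) = iterated_value H (w_word p) j (h \<circ> g)"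
proof -
  define g' where "g' = h \<circ> g"
  have g': "g' \<in> {1..3} \<rightarrow> carrier H" "g' 1 = h (g 1)" "g' 2 = h (g 2)" "g' 3 = h (g 3)"
    using assms by (auto simp: g'_def Pi_iff)
  have g: "g 1 \<in> carrier G" "g 2 \<in> carrier G" "g 3 \<in> carrier G" using assms by auto
  have "h (iterated_value G (w_word p) j g) = iterated_value H (w_word p) j g'"
  proof (induction j)
    case 0
    show ?case
      unfolding G.iterated_value_w_word_0[OF assms] H.iterated_value_w_word_0[OF g'(1)] g'(2-4)
      using g by (simp add: hom_nat_pow hom_commutator)
  next
    case (Suc j)
    then show ?case
      unfolding G.iterated_value_w_word_Suc[OF assms] H.iterated_value_w_word_Suc[OF g'(1)] g'(2-4)
      using g G.iterated_value_w_word_closed[OF assms] by (simp add: hom_nat_pow hom_commutator)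
  qed
  then show ?thesis by (simp add: g'_def)
qed

context G_relations
begin

text \<open>
  If \<open>p\<^sup>m\<close> annihilates the first iterate, which lies in \<open>K_torsion\<close>, then \<open>m\<close> more iterations give \<open>1\<close>.
\<close>

lemma satisfies_iterated_identity_w_word: "satisfies_iterated_identity G 3 (w_word p)"
  unfolding satisfies_iterated_identity_def
proof
  fix g :: "nat \<Rightarrow> 'a" assume g: "g \<in> {1..3} \<rightarrow> carrier G"
  let ?w = "\<lambda>j. iterated_value G (w_word p) j g"
  let ?z = "commutator G (g 2) (g 3)"
  have g_closed: "g 1 \<in> carrier G" "g 2 \<in> carrier G" "g 3 \<in> carrier G" using g by auto
  then have z: "?z \<in> N" "?z \<in> carrier G" by (auto intro: commutator_mem_N)
  have "?w 0 \<in> N"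
    using g_closed z subgroup_N
    by (simp add: iterated_value_w_word_0[OF g] subgroup_nat_pow_mem commutator_mem_N
        del: iterated_value.simps)
  then have "?w 1 \<in> K_torsion"
    using z commutator_mem_K_torsion subgroup_nat_pow_mem normal_imp_subgroup[OF normal_K_torsion]
    by (simp add: iterated_value_w_word_Suc[OF g] del: iterated_value.simps)
  then obtain m where m: "?w 1 [^] (p ^ m) = \<one>" by (auto simp: K_torsion_def)
  have "?w (Suc i) \<in> K_torsion \<and> ?w (Suc i) [^] (p ^ (m - i)) = \<one>" if "i \<le> m" for i
    using that
  proof (induction i)
    case 0
    then show ?case using \<open>?w 1 \<in> K_torsion\<close> m by simp
  next
    case (Suc i)
    then have "?w (Suc i) \<in> K_torsion" "?w (Suc i) [^] (p ^ Suc (m - Suc i)) = \<one>"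
      by (auto simp: Suc_diff_Suc simp del: iterated_value.simps power_Suc)
    from K_torsion_commutator_pow[OF this z(2)] show ?case
      by (simp add: iterated_value_w_word_Suc[OF g, of p "Suc i"] del: iterated_value.simps)
  qed
  from this[of m] have "?w (Suc m) = \<one>"
    using iterated_value_w_word_closed[OF g]
    by (simp del: iterated_value.simps)
  then show "\<exists>j. ?w j = \<one>" ..
qed

lemma iterated_value_1_mem_derived:
  assumes "g \<in> {1..3} \<rightarrow> carrier G"
  shows "iterated_value G (w_word p) 1 g \<in> (derived G ^^ 2) (carrier G)"
proof -
  have g: "g 1 \<in> carrier G" "g 2 \<in> carrier G" "g 3 \<in> carrier G" using assms by auto
  have D: "subgroup (derived G (carrier G)) G" "subgroup (derived G (derived G (carrier G))) G"
    by (simp_all add: derived_is_subgroup derived_in_carrier)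
  have z: "commutator G (g 2) (g 3) \<in> derived G (carrier G)"
    using g by (simp add: commutator_mem_derived subgroup_self)
  have "iterated_value G (w_word p) 0 g \<in> derived G (carrier G)"
    unfolding iterated_value_w_word_0[OF assms]
    using g by (simp add: subgroup_nat_pow_mem[OF D(1)] commutator_mem_derived subgroup_self)
  then show ?thesis
    using z by (simp add: iterated_value_w_word_Suc[OF assms] eval_nat_numeral
        subgroup_nat_pow_mem[OF D(2)] commutator_mem_derived[OF D(1)] del: iterated_value.simps)
qed

end

section \<open>A model by phase multiplications and shifts\<close>

text \<open>
  The triple \<open>(F, s, k)\<close> stands for the bijection \<open>(v, c, i) \<mapsto> (v F(c, i), c + s(i), i + k)\<close>, and the
  product for composition of maps, the right factor acting first. Triples have the advantage that powers,
  inverses and conjugates of the elements needed below have explicit formulas.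
\<close>

type_synonym twisted = "(real \<Rightarrow> int \<Rightarrow> complex) \<times> (int \<Rightarrow> real) \<times> int"

definition twisted_group :: "twisted monoid" where
  "twisted_group =
     \<lparr>carrier = {(F, s, k). \<forall>c i. F c i \<noteq> 0},
      monoid.mult = (\<lambda>(F, s, k) (F', s', k').
        (\<lambda>c i. F' c i * F (c + s' i) (i + k'), \<lambda>i. s' i + s (i + k'), k + k')),
      one = (\<lambda>_ _. 1, \<lambda>_. 0, 0)\<rparr>"

definition phase :: "(real \<Rightarrow> int \<Rightarrow> complex) \<Rightarrow> twisted" where
  "phase F = (F, \<lambda>_. 0, 0)"

definition shift :: "(int \<Rightarrow> real) \<Rightarrow> twisted" where
  "shift s = (\<lambda>_ _. 1, s, 0)"

definition translation :: "int \<Rightarrow> twisted" where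
  "translation k = (\<lambda>_ _. 1, \<lambda>_. 0, k)"

lemma twisted_group_simps:
  "(F, s, k) \<in> carrier twisted_group \<longleftrightarrow> (\<forall>c i. F c i \<noteq> 0)"
  "(F, s, k) \<otimes>\<^bsub>twisted_group\<^esub> (F', s', k') =
    (\<lambda>c i. F' c i * F (c + s' i) (i + k'), \<lambda>i. s' i + s (i + k'), k + k')"
  "\<one>\<^bsub>twisted_group\<^esub> = (\<lambda>_ _. 1, \<lambda>_. 0, 0)"
  by (simp_all add: twisted_group_def)

lemma group_twisted_group: "group twisted_group"
proof (rule groupI)
  fix g assume "g \<in> carrier twisted_group"
  then obtain F s k where g: "g = (F, s, k)" and F: "F c i \<noteq> 0" for c i
    by (cases g) (auto simp: twisted_group_simps)
  show "\<exists>h\<in>carrier twisted_group. h \<otimes>\<^bsub>twisted_group\<^esub> g = \<one>\<^bsub>twisted_group\<^esub>"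
    by (rule bexI[of _ "(\<lambda>c i. 1 / F (c - s (i - k)) (i - k), \<lambda>i. - s (i - k), - k)"])
      (auto simp: g F twisted_group_simps)
qed (auto simp: twisted_group_simps algebra_simps)

interpretation T: group twisted_group
  by (rule group_twisted_group)

lemma phase_closed [simp]: "phase F \<in> carrier twisted_group \<longleftrightarrow> (\<forall>c i. F c i \<noteq> 0)"
  and shift_closed [simp]: "shift s \<in> carrier twisted_group"
  and translation_closed [simp]: "translation k \<in> carrier twisted_group"
  by (simp_all add: twisted_group_simps phase_def shift_def translation_def)

lemma phase_mult: "phase F \<otimes>\<^bsub>twisted_group\<^esub> phase F' = phase (\<lambda>c i. F' c i * F c i)"
  and shift_mult: "shift s \<otimes>\<^bsub>twisted_group\<^esub> shift s' = shift (\<lambda>i. s' i + s i)"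
  and translation_mult:
    "translation k \<otimes>\<^bsub>twisted_group\<^esub> translation k' = translation (k + k')"
  and one_eq_phase: "\<one>\<^bsub>twisted_group\<^esub> = phase (\<lambda>_ _. 1)"
  and one_eq_shift: "\<one>\<^bsub>twisted_group\<^esub> = shift (\<lambda>_. 0)"
  and one_eq_translation: "\<one>\<^bsub>twisted_group\<^esub> = translation 0"
  by (simp_all add: twisted_group_simps phase_def shift_def translation_def)

lemma phase_eq_iff: "phase F = phase F' \<longleftrightarrow> F = F'"
  by (simp add: phase_def)

lemma phase_inv:
  "\<forall>c i. F c i \<noteq> 0 \<Longrightarrow> inv\<^bsub>twisted_group\<^esub> phase F = phase (\<lambda>c i. 1 / F c i)"
  by (rule T.inv_equality) (simp_all add: phase_mult one_eq_phase)

lemma shift_inv: "inv\<^bsub>twisted_group\<^esub> shift s = shift (\<lambda>i. - s i)"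
  by (rule T.inv_equality) (simp_all add: shift_mult one_eq_shift)

lemma translation_inv: "inv\<^bsub>twisted_group\<^esub> translation k = translation (- k)"
  by (rule T.inv_equality) (simp_all add: translation_mult one_eq_translation)

lemma phase_pow: "phase F [^]\<^bsub>twisted_group\<^esub> (n :: nat) = phase (\<lambda>c i. F c i ^ n)"
  by (induction n) (simp_all add: phase_mult one_eq_phase)

lemma shift_pow: "shift s [^]\<^bsub>twisted_group\<^esub> (n :: nat) = shift (\<lambda>i. real n * s i)"
  by (induction n) (simp_all add: shift_mult one_eq_shift algebra_simps)

lemma shift_int_pow:
  "shift s [^]\<^bsub>twisted_group\<^esub> (n :: int) = shift (\<lambda>i. real_of_int n * s i)"
  by (auto simp: int_pow_def2 shift_pow shift_inv)

lemma translation_pow: "translation 1 [^]\<^bsub>twisted_group\<^esub> (n :: nat) = translation (int n)"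
  by (induction n) (simp_all add: translation_mult one_eq_translation algebra_simps)

lemma translation_int_pow: "translation 1 [^]\<^bsub>twisted_group\<^esub> (n :: int) = translation n"
  by (auto simp: int_pow_def2 translation_pow translation_inv)

lemma conjugate_phase_shift:
  "conjugate twisted_group (phase F) (shift s) = phase (\<lambda>c i. F (c + s i) i)"
  unfolding conjugate_def shift_inv
  by (simp add: phase_def shift_def twisted_group_simps)

lemma conjugate_phase_translation:
  "conjugate twisted_group (phase F) (translation k) = phase (\<lambda>c i. F c (i + k))"
  unfolding conjugate_def translation_inv
  by (simp add: phase_def translation_def twisted_group_simps)

lemma conjugate_shift_translation:
  "conjugate twisted_group (shift s) (translation k) = shift (\<lambda>i. s (i + k))"
  unfolding conjugate_def translation_inv
  by (simp add: shift_def translation_def twisted_group_simps)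

lemma commutator_phase_shift:
  assumes "\<forall>c i. F c i \<noteq> 0"
  shows "commutator twisted_group (phase F) (shift s) = phase (\<lambda>c i. F (c + s i) i / F c i)"
  using assms
  by (simp add: T.commutator_eq_inv_mult_conjugate conjugate_phase_shift phase_inv phase_mult)

lemma commutator_shift_translation:
  "commutator twisted_group (shift s) (translation k) = shift (\<lambda>i. s (i + k) - s i)"
  by (simp add: T.commutator_eq_inv_mult_conjugate conjugate_shift_translation shift_inv shift_mult)

text \<open>
  The images of \<open>x\<close> and \<open>y\<close> will be \<open>phase (unit_phase p)\<close> and \<open>shift (unit_shift p)\<close>, and \<open>t\<close> becomes
  \<open>translation 1\<close>.
\<close>

definition unit_phase :: "nat \<Rightarrow> real \<Rightarrow> int \<Rightarrow> complex" where
  "unit_phase p c i = (if c \<in> \<int> then cis (2 * pi * real p powi i) else 1)"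

definition unit_shift :: "nat \<Rightarrow> int \<Rightarrow> real" where
  "unit_shift p i = real p powi (- i)"

lemma unit_phase_nonzero [simp]: "unit_phase p c i \<noteq> 0"
  by (simp add: unit_phase_def)

lemma power_int_mem_Ints: "i \<ge> 0 \<Longrightarrow> real p powi i \<in> \<int>"
  by (simp add: power_int_def)

text \<open>
  For \<open>i \<ge> 0\<close> the phase \<open>exp(2\<pi>\<i>p\<^sup>i)\<close> is trivial; for \<open>i < 0\<close> the shift by \<open>p\<^sup>-\<^sup>i\<close> preserves the integers.
  So \<open>x\<close> and \<open>y\<close> commute, although shifts by other powers of \<open>p\<close> do not preserve the phase of \<open>x\<close>.
\<close>

lemma unit_phase_shift:
  "unit_phase p (c + unit_shift p i) i = unit_phase p c i"
proof (cases "i \<ge> 0")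
  case True
  then show ?thesis by (simp add: unit_phase_def power_int_mem_Ints)
next
  case False
  then have "real p powi (- i) \<in> \<int>" by (simp add: power_int_mem_Ints)
  then have "c + real p powi (- i) \<in> \<int> \<longleftrightarrow> c \<in> \<int>"
    by (metis Ints_add Ints_diff add_diff_cancel_right')
  then show ?thesis by (simp add: unit_phase_def unit_shift_def)
qed

lemma twisted_group_relations:
  assumes p: "p > 0"
  defines "x \<equiv> phase (unit_phase p)" and "y \<equiv> shift (unit_shift p)" and "t \<equiv> translation 1"
  shows "conjugate twisted_group x t = x [^]\<^bsub>twisted_group\<^esub> p"
    and "conjugate twisted_group y (inv\<^bsub>twisted_group\<^esub> t) = y [^]\<^bsub>twisted_group\<^esub> p"
    and "commutator twisted_group x y = \<one>\<^bsub>twisted_group\<^esub>"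
    and "commutator twisted_group (commutator twisted_group x
           (conjugate twisted_group (y [^]\<^bsub>twisted_group\<^esub> (j :: int))
              (t [^]\<^bsub>twisted_group\<^esub> (i :: int)))) x = \<one>\<^bsub>twisted_group\<^esub>"
proof -
  have "unit_phase p c (i + 1) = unit_phase p c i ^ p" for c i
    using p by (simp add: unit_phase_def DeMoivre power_int_add mult_ac)
  then show "conjugate twisted_group x t = x [^]\<^bsub>twisted_group\<^esub> p"
    by (simp add: x_def t_def conjugate_phase_translation phase_pow)
  have "unit_shift p (i - 1) = p * unit_shift p i" for i
    using p power_int_add[of "real p" "- i" 1] by (simp add: unit_shift_def)
  then show "conjugate twisted_group y (inv\<^bsub>twisted_group\<^esub> t) = y [^]\<^bsub>twisted_group\<^esub> p"
    by (simp add: y_def t_def translation_inv conjugate_shift_translation shift_pow)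
  show "commutator twisted_group x y = \<one>\<^bsub>twisted_group\<^esub>"
    by (simp add: x_def y_def commutator_phase_shift unit_phase_shift one_eq_phase)
  show "commutator twisted_group (commutator twisted_group x
           (conjugate twisted_group (y [^]\<^bsub>twisted_group\<^esub> (j :: int))
              (t [^]\<^bsub>twisted_group\<^esub> (i :: int)))) x = \<one>\<^bsub>twisted_group\<^esub>"
    by (simp add: x_def y_def t_def shift_int_pow translation_int_pow conjugate_shift_translation
        commutator_phase_shift T.commutator_eq_one_iff phase_mult mult.commute)
qed

text \<open>
  The effect of \<open>u \<mapsto> [u, z]\<^sup>p\<close> on phases when \<open>z\<close> is the shift by \<open>s\<close>: on arguments of the complex phases it is
  \<open>p\<close> times the difference operator with step \<open>s\<close>.
\<close>

definition word_step :: "nat \<Rightarrow> (int \<Rightarrow> real) \<Rightarrow> (real \<Rightarrow> int \<Rightarrow> complex) \<Rightarrow> real \<Rightarrow> int \<Rightarrow> complex" where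
  "word_step p s F = (\<lambda>c i. (F (c + s i) i / F c i) ^ p)"

lemma word_step_iterate_nonzero:
  assumes "\<forall>c i. F c i \<noteq> 0"
  shows "\<forall>c i. (word_step p s ^^ n) F c i \<noteq> 0"
  using assms by (induction n) (simp_all add: word_step_def)

lemma commutator_phase_shift_pow:
  assumes "\<forall>c i. F c i \<noteq> 0"
  shows "commutator twisted_group (phase F) (shift s) [^]\<^bsub>twisted_group\<^esub> p = phase (word_step p s F)"
  using assms by (simp add: commutator_phase_shift phase_pow word_step_def)

lemma iterated_value_twisted_group:
  assumes g: "g \<in> {1..3} \<rightarrow> carrier twisted_group" and F: "\<forall>c i. F c i \<noteq> 0"
    and g1: "g 1 = phase F" and z: "commutator twisted_group (g 2) (g 3) = shift s"
  shows "iterated_value twisted_group (w_word p) j g = phase ((word_step p s ^^ Suc j) F)"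
proof (induction j)
  case 0
  show ?case
    unfolding T.iterated_value_w_word_0[OF g] g1 z
    using F by (simp add: commutator_phase_shift_pow)
next
  case (Suc j)
  show ?case
    unfolding T.iterated_value_w_word_Suc[OF g] z Suc
    using commutator_phase_shift_pow[OF word_step_iterate_nonzero[OF F, where n = "Suc j"]]
    by simp
qed

text \<open>
  If the phase is trivial at \<open>s, 2s, \<dots>, Ls\<close>, the \<open>n\<close>-th iterate at \<open>0\<close> depends only on the argument
  at \<open>0\<close>, which enters with the coefficient \<open>(-p)\<^sup>n\<close>. Each step consumes one of the trivial values, whence
  the bound \<open>L\<close>.
\<close>

lemma word_step_iterate_eq:
  assumes "F 0 i = cis \<theta>" and "\<And>l. 1 \<le> l \<Longrightarrow> l \<le> L \<Longrightarrow> F (real l * s i) i = 1" and "n \<le> L"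
  shows "(word_step p s ^^ n) F 0 i = cis ((- real p) ^ n * \<theta>) \<and>
    (\<forall>l. 1 \<le> l \<and> l + n \<le> L \<longrightarrow> (word_step p s ^^ n) F (real l * s i) i = 1)"
  using assms(3)
proof (induction n)
  case 0
  then show ?case using assms(1,2) by simp
next
  case (Suc n)
  have step: "(word_step p s ^^ Suc n) F (real l * s i) i =
      ((word_step p s ^^ n) F (real (Suc l) * s i) i / (word_step p s ^^ n) F (real l * s i) i) ^ p"
    for l by (simp add: word_step_def algebra_simps)
  have "(word_step p s ^^ n) F (real (Suc 0) * s i) i = 1"
    using Suc by (auto dest!: spec[of _ 1])
  then have "(word_step p s ^^ Suc n) F 0 i = (1 / cis ((- real p) ^ n * \<theta>)) ^ p"
    using Suc step[of 0] by simp
  also have "\<dots> = cis ((- real p) ^ Suc n * \<theta>)"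
    by (simp add: divide_inverse DeMoivre mult_ac)
  finally show ?case
    using Suc step by auto
qed

lemma cis_2pi_eq_1_iff: "cis (2 * pi * r) = 1 \<longleftrightarrow> r \<in> \<int>"
proof
  assume "cis (2 * pi * r) = 1"
  then have "cos (2 * pi * r) = 1" by (metis cis.sel(1) one_complex.sel(1))
  then obtain n :: int where "2 * pi * r = of_int n * 2 * pi" using cos_one_2pi_int by blast
  then have "r = of_int n" by simp
  then show "r \<in> \<int>" by simp
qed simp

lemma not_Ints_if_abs_between_0_1: "0 < \<bar>r\<bar> \<Longrightarrow> \<bar>r\<bar> < 1 \<Longrightarrow> (r :: real) \<notin> \<int>"
  by (auto elim!: Ints_cases)

text \<open>
  The witnesses are \<open>x\<^sub>n\<close>, \<open>y\<^sub>k\<close> and \<open>t\<close>. The index \<open>n = j + 2\<close> leaves a primitive \<open>p\<close>-th root of unity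
  after the \<open>j + 1\<close> multiplications by \<open>p\<close>. The index \<open>k\<close> is so large that the shift
  \<open>(1 - p) / p\<^sup>k\<^sup>+\<^sup>1\<close> given by \<open>[y\<^sub>k, t]\<close> at \<open>i = 0\<close> has no integral multiple among its first \<open>j + 1\<close> multiples.
\<close>

lemma G_group_iterated_value_ne_one:
  assumes p: "p \<ge> 2"
  shows "\<exists>g \<in> {1..3} \<rightarrow> carrier (G_group p). iterated_value (G_group p) (w_word p) j g \<noteq> \<one>\<^bsub>G_group p\<^esub>"
proof -
  define f where "f = case_generator (phase (unit_phase p)) (shift (unit_shift p)) (translation 1)"
  have f: "f \<in> UNIV \<rightarrow> carrier twisted_group"
    by (auto simp: f_def split: generator.split)
  interpret ev: group_hom "free_group UNIV" twisted_group "free_eval twisted_group f"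
    using f by (rule T.group_hom_free_eval)
  have f_gen: "free_eval twisted_group f (free_gen gen_x) = phase (unit_phase p)"
    "free_eval twisted_group f (free_gen gen_y) = shift (unit_shift p)"
    "free_eval twisted_group f (free_gen gen_t) = translation 1"
    by (simp_all add: T.free_eval_free_gen f_def)
  have "p > 0" using p by simp
  then have rel: "\<forall>(u, v) \<in> relations p. free_eval twisted_group f u = free_eval twisted_group f v"
    unfolding hom_relations_iff[OF ev.group_hom_axioms] f_gen
    using twisted_group_relations by blast
  obtain h where h: "group_hom (presented_group UNIV (relations p)) twisted_group h"
    and h_gen: "\<And>a. h (proj p (free_gen a)) = f a"
    by (rule universal_property[OF group_twisted_group f, of p]) (use rel in auto)
  interpret G_relations "G_group p" "proj p (free_gen gen_x)" "proj p (free_gen gen_y)"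
    "proj p (free_gen gen_t)" p by (rule G_relations_G_group)
  interpret h: group_hom "G_group p" twisted_group h
    using h by (simp add: G_group_def)
  let ?t = "proj p (free_gen gen_t)"
  define k where "k = (j + 2) * p"
  define n where "n = j + 2"
  define g where "g = (\<lambda>m :: nat. if m = 1 then x_root (int n) else if m = 2 then y_root (int k) else ?t)"
  have g: "g \<in> {1..3} \<rightarrow> carrier (G_group p)" by (auto simp: g_def)
  then have hg: "h \<circ> g \<in> {1..3} \<rightarrow> carrier twisted_group" by (auto simp: Pi_iff)
  define F where "F = (\<lambda>c i. unit_phase p c (i - int n))"
  define s where "s = (\<lambda>i. unit_shift p (i + int k + 1) - unit_shift p (i + int k))"
  have "(h \<circ> g) 1 = phase F"
    by (simp add: g_def x_root_def h.hom_conjugate h.hom_int_pow h_gen f_def translation_int_pow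
        conjugate_phase_translation F_def)
  moreover have "commutator twisted_group ((h \<circ> g) 2) ((h \<circ> g) 3) = shift s"
    by (simp add: g_def y_root_def h.hom_conjugate h.hom_int_pow h_gen f_def translation_int_pow
        conjugate_shift_translation commutator_shift_translation s_def algebra_simps)
  ultimately have h_value: "h (iterated_value (G_group p) (w_word p) j g)
      = phase ((word_step p s ^^ Suc j) F)"
    unfolding h.hom_iterated_value_w_word[OF g]
    by (intro iterated_value_twisted_group[OF hg]) (simp_all add: F_def)
  have s0: "s 0 = - ((real p - 1) / real p ^ Suc k)"
    using p by (simp add: s_def unit_shift_def power_int_minus power_int_def field_simps nat_add_distrib)
  have "real l * s 0 \<notin> \<int>" if "1 \<le> l" "l \<le> Suc j" for l
  proof (rule not_Ints_if_abs_between_0_1)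
    show "0 < \<bar>real l * s 0\<bar>" using p that by (simp add: s0)
    have "l * (p - 1) \<le> k" unfolding k_def using that by (intro mult_le_mono) auto
    also have "k < 2 ^ k" by (rule less_exp)
    also have "\<dots> \<le> p ^ k" using p by (simp add: power_mono)
    also have "\<dots> \<le> p ^ Suc k" using p by simp
    finally have "real (l * (p - 1)) < real p ^ Suc k" by (metis of_nat_less_iff of_nat_power)
    moreover have "\<bar>real l * s 0\<bar> = real (l * (p - 1)) / real p ^ Suc k"
      using p by (simp add: s0 abs_mult of_nat_diff)
    ultimately show "\<bar>real l * s 0\<bar> < 1"
      using p by (simp add: divide_less_eq del: power_Suc of_nat_mult)
  qed
  then have "F (real l * s 0) 0 = 1" if "1 \<le> l" "l \<le> Suc j" for l
    using that by (simp add: F_def unit_phase_def)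
  moreover have "F 0 0 = cis (2 * pi * (1 / real p ^ n))"
    by (simp add: F_def unit_phase_def power_int_minus divide_inverse)
  ultimately have "(word_step p s ^^ Suc j) F 0 0 = cis ((- real p) ^ Suc j * (2 * pi * (1 / real p ^ n)))"
    using word_step_iterate_eq[where F = F and i = 0 and L = "Suc j" and s = s and n = "Suc j" and p = p] by blast
  also have "\<dots> = cis (2 * pi * ((- 1) ^ Suc j / real p))"
    using p by (simp add: n_def power_minus[of "real p"] field_simps)
  also have "\<dots> \<noteq> 1"
    unfolding cis_2pi_eq_1_iff
    by (rule not_Ints_if_abs_between_0_1) (use p in \<open>simp_all add: power_abs abs_mult\<close>)
  finally have "(word_step p s ^^ Suc j) F \<noteq> (\<lambda>_ _. 1)" by metis
  then have "h (iterated_value (G_group p) (w_word p) j g) \<noteq> h \<one>\<^bsub>G_group p\<^esub>"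
    unfolding h_value h.hom_one one_eq_phase phase_eq_iff .
  then show ?thesis using g by metis
qed

theorem theorem1:
  fixes p :: nat
  assumes "prime p"
  shows "solvable (G_group p) \<and> derived_length (G_group p) = 3 \<and>
    unbounded_iterated_identity (G_group p) 3 (w_word p)"
proof -
  interpret G_relations "G_group p" "proj p (free_gen gen_x)" "proj p (free_gen gen_y)"
    "proj p (free_gen gen_t)" p by (rule G_relations_G_group)
  let ?D = "\<lambda>n. (derived (G_group p) ^^ n) (carrier (G_group p))"
  note ne_one = G_group_iterated_value_ne_one[OF prime_ge_2_nat[OF assms]]
  have "?D 2 \<noteq> {\<one>\<^bsub>G_group p\<^esub>}"
    using ne_one[of 1] iterated_value_1_mem_derived by blast
  have "?D n \<noteq> {\<one>\<^bsub>G_group p\<^esub>}" if "n \<le> 2" for n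
  proof
    assume "?D n = {\<one>\<^bsub>G_group p\<^esub>}"
    moreover have "?D 2 = (derived (G_group p) ^^ (2 - n)) (?D n)"
      using that by (simp add: funpow_add[symmetric, THEN fun_cong, unfolded comp_apply])
    moreover have "(derived (G_group p) ^^ m) {\<one>\<^bsub>G_group p\<^esub>} \<subseteq> {\<one>\<^bsub>G_group p\<^esub>}" for m
      by (induction m) (auto dest!: derived_incl[OF _ triv_subgroup])
    moreover have "\<one>\<^bsub>G_group p\<^esub> \<in> ?D 2"
      by (intro subgroup.one_closed exp_of_derived_is_subgroup subgroup_self)
    ultimately show False using \<open>?D 2 \<noteq> {\<one>\<^bsub>G_group p\<^esub>}\<close> by auto
  qed
  then have "derived_length (G_group p) = 3"
    unfolding derived_length_def using derived_3_trivial
    by (intro Least_equality) (force simp: not_less_eq_eq[symmetric] numeral_eq_Suc)+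
  moreover have "solvable (G_group p)"
    using derived_3_trivial solvable_iff_trivial_derived_seq by blast
  moreover have "unbounded_iterated_identity (G_group p) 3 (w_word p)"
    unfolding unbounded_iterated_identity_def
    using satisfies_iterated_identity_w_word ne_one by blast
  ultimately show ?thesis by blast
qed

end
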